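(* Let $h\in\{2,3,6\}$ and let $g$ be a positive integer. There exists a $(gh,h,4,1)$-CDF if and only if $gh\equiv h\pmod{12}$, $g\geq 4$ and $(g,h)\notin\{(9,3),(5,6)\}$.
   Context: For positive integers $g,h$ and an integer $k$ with $2\le k\le gh$, let $g\mathbb{Z}_{gh}$ denote the subgroup of order $h$ of the cyclic group $\mathbb{Z}_{gh}$ (generated by $g$). A $(gh,h,k,1)$-CDF (cyclic relative difference family) is a nonempty set $\mathcal{F}$ of $k$-subsets of $\mathbb{Z}_{gh}$ (called base blocks) such that the multiset (multiplicities preserved) $\bigcup_{F\in\mathcal{F}}\{f-f' : f,f'\in F,\ f\neq f'\}$ contains each element of $\mathbb{Z}_{gh}\setminus g\mathbb{Z}_{gh}$ exactly once and each element of $g\mathbb{Z}_{gh}$ zero times. *)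

theory Defs
  imports "HOL-Algebra.Elementary_Groups" "HOL-Library.Multiset" "HOL-Number_Theory.Cong"
begin

text \<open>
  \<^const>\<open>integer_mod_group\<close> \<open>n\<close> is the cyclic group of residues \<open>{0..<n}\<close> for \<open>n > 0\<close>.
  The generator is reduced modulo \<open>g * h\<close> so that it is a residue also when \<open>h = 1\<close>.
\<close>

definition mult_subgroup :: "nat \<Rightarrow> nat \<Rightarrow> int set" where
  "mult_subgroup g h = generate (integer_mod_group (g * h)) {int g mod int (g * h)}"

definition differences :: "nat \<Rightarrow> int set \<Rightarrow> int multiset" where
  "differences n F =
    image_mset (\<lambda>(x, y). x \<otimes>\<^bsub>integer_mod_group n\<^esub> (inv\<^bsub>integer_mod_group n\<^esub> y))
      (mset_set {(x, y). x \<in> F \<and> y \<in> F \<and> x \<noteq> y})"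

definition is_CDF :: "nat \<Rightarrow> nat \<Rightarrow> nat \<Rightarrow> int set set \<Rightarrow> bool" where
  "is_CDF g h k \<F> \<longleftrightarrow>
    0 < g \<and> 0 < h \<and> 2 \<le> k \<and> k \<le> g * h \<and>
    \<F> \<noteq> {} \<and>
    (\<forall>F \<in> \<F>. F \<subseteq> carrier (integer_mod_group (g * h)) \<and> card F = k) \<and>
    (\<forall>d \<in> carrier (integer_mod_group (g * h)).
      count (\<Sum>F\<in>\<F>. differences (g * h) F) d = (if d \<in> mult_subgroup g h then 0 else 1))"

end

theory Submission
  imports Defs
begin

text \<open>
  The order of the group is \<open>12 * t + h\<close>, where \<open>t\<close> is the number of base blocks, so \<open>t\<close> blocks
  form a CDF as soon as their differences cover all residues outside the subgroup. For
  \<open>t = 6 * n + r\<close> almost all blocks are put into six families of about \<open>n\<close> blocks each; a family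
  moves its four points with velocities 0, 1, 2, 3, so that its differences form arithmetic
  progressions with steps 1, 1, 1, 2, 2, 3 and lengths about \<open>n\<close>. Up to sign, the residues are cut
  by the multiples of \<open>n\<close> into 36 cells, each of which is filled by one progression of step 1, by
  two of step 2 or by three of step 3. About a dozen fixed blocks repair the defects near the
  multiples of \<open>n\<close>; since only bounded offsets are involved there, one finite check is valid for all
  large \<open>n\<close>. Small \<open>t\<close> need explicit blocks, and the exceptional parameters an exhaustive search.
\<close>

section \<open>Counting differences\<close>

text \<open>The generated subgroup consists of the residues of the multiples \<open>k * g\<close>,
  and reduction modulo a multiple of \<open>g\<close> preserves divisibility by
  \<open>g\<close>.\<close>

lemma mult_subgroup_iff:
  assumes "0 < g" "0 < h" "d \<in> carrier (integer_mod_group (g * h))"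
  shows "d \<in> mult_subgroup g h \<longleftrightarrow> int g dvd d"
proof -
  let ?v = "int (g * h)"
  let ?G = "integer_mod_group (g * h)"
  have v: "0 < ?v" using assms by simp
  have gc: "int g mod ?v \<in> carrier ?G"
    using v by (simp add: carrier_integer_mod_group)
  have "mult_subgroup g h = {(k * (int g mod ?v)) mod ?v | k. k \<in> (UNIV :: int set)}"
    unfolding mult_subgroup_def
    using group.generate_pow[OF group_integer_mod_group gc]
    by (simp add: int_pow_integer_mod_group)
  also have "\<dots> = {(k * int g) mod ?v | k. k \<in> (UNIV :: int set)}"
    by (simp add: mod_mult_right_eq)
  finally have eq: "mult_subgroup g h = {(k * int g) mod ?v | k. k \<in> (UNIV :: int set)}" .
  show ?thesis
  proof
    assume "d \<in> mult_subgroup g h"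
    then obtain k where "d = (k * int g) mod ?v" using eq by auto
    then show "int g dvd d" by (simp add: dvd_mod)
  next
    assume "int g dvd d"
    then obtain k where "d = int g * k" by auto
    moreover have "d mod ?v = d"
      using assms v by (auto simp: carrier_integer_mod_group)
    ultimately have "d = (k * int g) mod ?v" by (metis mult.commute)
    then show "d \<in> mult_subgroup g h" using eq by blast
  qed
qed

lemma differences_eq:
  assumes "0 < n" "F \<subseteq> carrier (integer_mod_group n)"
  shows "differences n F =
    image_mset (\<lambda>(x, y). (x - y) mod int n) (mset_set {(x, y). x \<in> F \<and> y \<in> F \<and> x \<noteq> y})"
  unfolding differences_def
proof (rule image_mset_cong)
  fix p assume p: "p \<in># mset_set {(x, y). x \<in> F \<and> y \<in> F \<and> x \<noteq> y}"
  have "finite F" using assms finite_subset by (fastforce simp: carrier_integer_mod_group)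
  then have "finite {(x, y). x \<in> F \<and> y \<in> F \<and> x \<noteq> y}"
    by (rule_tac finite_subset[of _ "F \<times> F"]) auto
  then obtain x y where "p = (x, y)" "x \<in> F" "y \<in> F" using p by auto
  then show "(case p of (x, y) \<Rightarrow> x \<otimes>\<^bsub>integer_mod_group n\<^esub> inv\<^bsub>integer_mod_group n\<^esub> y)
      = (case p of (x, y) \<Rightarrow> (x - y) mod int n)"
    using assms by (auto simp: mod_simps)
qed

lemma mem_differences_iff:
  assumes "0 < n" "F \<subseteq> {0..<int n}"
  shows "d \<in># differences n F \<longleftrightarrow> (\<exists>x\<in>F. \<exists>y\<in>F. x \<noteq> y \<and> d = (x - y) mod int n)"
proof -
  have "finite F" using assms(2) finite_subset by blast
  then have "finite {(x, y). x \<in> F \<and> y \<in> F \<and> x \<noteq> y}"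
    by (rule_tac finite_subset[of _ "F \<times> F"]) auto
  then show ?thesis
    using assms by (subst differences_eq) (auto simp: carrier_integer_mod_group image_iff)
qed

lemma card_off_diagonal:
  assumes "finite F"
  shows "card {(x, y). x \<in> F \<and> y \<in> F \<and> x \<noteq> y} = card F * (card F - 1)"
proof -
  have "{(x, y). x \<in> F \<and> y \<in> F \<and> x \<noteq> y} = (SIGMA x:F. F - {x})" by auto
  then show ?thesis using assms by simp
qed

lemma size_differences: "finite F \<Longrightarrow> size (differences n F) = card F * (card F - 1)"
  by (simp add: differences_def card_off_diagonal)

definition relative_residues :: "nat \<Rightarrow> nat \<Rightarrow> int set" where
  "relative_residues g h = {d. 0 \<le> d \<and> d < int (g * h) \<and> \<not> int g dvd d}"

lemma finite_relative_residues [simp]: "finite (relative_residues g h)"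
  by (rule finite_subset[of _ "{0..<int (g * h)}"]) (auto simp: relative_residues_def)

lemma card_relative_residues:
  assumes "0 < g" "0 < h"
  shows "card (relative_residues g h) = g * h - h"
proof -
  let ?A = "{0..<int (g * h)}" and ?B = "(\<lambda>k. int g * k) ` {0..<int h}"
  have "x \<in> ?B" if x: "0 \<le> x" "x < int (g * h)" "int g dvd x" for x
  proof -
    from x(3) obtain k where k: "x = int g * k" by auto
    with x assms have "0 \<le> k" "k < int h"
      by (auto simp: zero_le_mult_iff)
    with k show ?thesis by auto
  qed
  then have "relative_residues g h = ?A - ?B"
    using assms by (auto simp: relative_residues_def)
  moreover have "?B \<subseteq> ?A" using assms by auto
  moreover have "card ?B = h"
    using assms by (subst card_image) (auto simp: inj_on_def)
  ultimately show ?thesis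
    by (simp add: card_Diff_subset nat_mult_distrib del: of_nat_mult)
qed

text \<open>The count condition speaks of group elements only. Neither a difference nor a relative
  residue lies outside the group, so the counts agree everywhere and merge into one multiset
  equation, to which size arguments apply.\<close>

lemma is_CDF_iff:
  assumes "0 < g" "0 < h"
  shows "is_CDF g h 4 \<F> \<longleftrightarrow> 4 \<le> g * h \<and> \<F> \<noteq> {} \<and>
    (\<forall>F \<in> \<F>. F \<subseteq> {0..<int (g * h)} \<and> card F = 4) \<and>
    (\<Sum>F\<in>\<F>. differences (g * h) F) = mset_set (relative_residues g h)"
proof -
  let ?v = "g * h" and ?S = "\<Sum>F\<in>\<F>. differences (g * h) F"
  have v: "0 < ?v" using assms by simp
  have "(\<forall>d \<in> carrier (integer_mod_group ?v). count ?S d = (if d \<in> mult_subgroup g h then 0 else 1))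
      \<longleftrightarrow> ?S = mset_set (relative_residues g h)"
    if sub: "\<forall>F \<in> \<F>. F \<subseteq> carrier (integer_mod_group ?v)"
  proof -
    have mem: "0 \<le> d \<and> d < int ?v" if "d \<in># ?S" for d
    proof -
      \<comment> \<open>A sum over an infinite family would be the empty multiset by convention; a
        family of subsets of a finite group is finite, so each element of the sum stems from some
        block.\<close>
      have fin: "finite \<F>"
        using sub v finite_subset[of \<F> "Pow {0..<int ?v}"] by (auto simp: carrier_integer_mod_group)
      with that obtain F where "F \<in> \<F>" "d \<in># differences ?v F"
        by (auto simp: set_mset_sum)
      then show ?thesis
        using differences_eq[OF v] sub v by auto
    qed
    have "count (mset_set (relative_residues g h)) d = (if d \<in> mult_subgroup g h then 0 else 1)"
      if "d \<in> carrier (integer_mod_group ?v)" for d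
      using mult_subgroup_iff[OF assms that] that v finite_relative_residues[of g h]
      by (simp add: count_mset_set' carrier_integer_mod_group) (simp add: relative_residues_def)
    moreover have "count ?S d = 0" "count (mset_set (relative_residues g h)) d = 0"
      if "d \<notin> carrier (integer_mod_group ?v)" for d
      using mem that v
      by (auto simp: count_eq_zero_iff relative_residues_def carrier_integer_mod_group count_mset_set')
    ultimately show ?thesis
      by (metis multiset_eqI)
  qed
  then show ?thesis
    using assms by (auto simp: is_CDF_def carrier_integer_mod_group)
qed

lemma finite_CDF:
  assumes "0 < g" "0 < h" "is_CDF g h 4 \<F>"
  shows "finite \<F>"
  using assms finite_subset[of \<F> "Pow {0..<int (g * h)}"] by (auto simp: is_CDF_iff)

text \<open>Double counting: each block of four points contributes 12 ordered differences.\<close>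

lemma card_CDF:
  assumes "0 < g" "0 < h" "is_CDF g h 4 \<F>"
  shows "12 * card \<F> = g * h - h"
proof -
  have "g * h - h = size (\<Sum>F\<in>\<F>. differences (g * h) F)"
    using assms by (simp add: is_CDF_iff card_relative_residues del: size_multiset_sum)
  also have "\<dots> = (\<Sum>F\<in>\<F>. size (differences (g * h) F))"
    by simp
  also have "\<dots> = (\<Sum>F\<in>\<F>. 12)"
  proof (rule sum.cong)
    fix F assume "F \<in> \<F>"
    then have "card F = 4" using assms by (simp add: is_CDF_iff)
    moreover from this have "finite F" by (metis card.infinite zero_neq_numeral)
    ultimately show "size (differences (g * h) F) = 12" by (simp add: size_differences)
  qed simp
  finally show ?thesis
    by simp
qed

lemma mset_set_subseteqI:
  assumes "\<And>x. x \<in> T \<Longrightarrow> x \<in># S"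
  shows "mset_set T \<subseteq># S"
  using assms by (intro mset_subset_eqI) (auto simp: count_mset_set' Suc_le_eq)

text \<open>
  A cover suffices: \<open>t\<close> blocks of size at most four have at most \<open>12 * t\<close> differences, so if every
  residue outside the subgroup occurs, none occurs twice and all blocks have exactly four elements.
\<close>

lemma is_CDF_if_cover:
  assumes gh: "0 < g" "0 < h" and v: "g * h = 12 * t + h" and "0 < t"
    and fin: "finite \<F>" and card: "card \<F> \<le> t"
    and F: "\<And>F. F \<in> \<F> \<Longrightarrow> F \<subseteq> {0..<int (g * h)} \<and> card F \<le> 4"
    and cover: "\<And>d. d \<in> relative_residues g h \<Longrightarrow>
      \<exists>F \<in> \<F>. \<exists>x \<in> F. \<exists>y \<in> F. d = (x - y) mod int (g * h)"
  shows "is_CDF g h 4 \<F>"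
proof -
  let ?v = "g * h" and ?D = "\<lambda>F. differences (g * h) F"
  let ?S = "\<Sum>F\<in>\<F>. ?D F" and ?T = "relative_residues g h"
  have v0: "0 < ?v" using gh by simp
  have finF: "finite F" if "F \<in> \<F>" for F
    using F[OF that] finite_subset by blast
  have size_S: "size ?S = (\<Sum>F\<in>\<F>. card F * (card F - 1))"
    unfolding size_multiset_sum using finF by (intro sum.cong) (auto simp: size_differences)
  have bound: "card F * (card F - 1) \<le> 12" if "F \<in> \<F>" for F
    using mult_le_mono[of "card F" 4 "card F - 1" 3] F[OF that] by (simp add: le_diff_conv)
  have sub: "mset_set ?T \<subseteq># ?S"
  proof -
    have "d \<in># ?S" if d: "d \<in> ?T" for d
    proof -
      obtain F x y where "F \<in> \<F>" "x \<in> F" "y \<in> F" and dxy: "d = (x - y) mod int ?v"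
        using cover[OF d] by blast
      moreover have "x \<noteq> y" using d dxy by (auto simp: relative_residues_def)
      ultimately have "d \<in># ?D F"
        using F[OF \<open>F \<in> \<F>\<close>] v0 by (subst mem_differences_iff) blast+
      then show ?thesis using fin \<open>F \<in> \<F>\<close> by (auto simp: set_mset_sum)
    qed
    then show ?thesis by (rule mset_set_subseteqI)
  qed
  have size_T: "size (mset_set ?T) = 12 * t"
    using card_relative_residues[OF gh] v by simp
  have "size ?S \<le> (\<Sum>F\<in>\<F>. 12)" unfolding size_S using bound by (rule sum_mono)
  also have "\<dots> \<le> 12 * t" using card by simp
  finally have le: "size ?S \<le> 12 * t" .
  \<comment> \<open>The included multiset has size \<open>12 * t\<close> already, so the inclusion
    is an equality.\<close>
  then have S: "?S = mset_set ?T"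
    using sub size_T by (metis le_antisym size_mset_mono mset_subset_size subset_mset.le_less not_less)
  have "card F = 4" if "F \<in> \<F>" for F
  proof (rule ccontr)
    assume "card F \<noteq> 4"
    then have "card F \<le> 3" using F[OF that] by auto
    then have "card F * (card F - 1) < 12"
      using mult_le_mono[of "card F" 3 "card F - 1" 2] by (simp add: le_diff_conv)
    \<comment> \<open>A block with at most three points has at most 6 differences, which the other
      blocks cannot make up for.\<close>
    then have "size ?S < (\<Sum>F\<in>\<F>. 12)"
      unfolding size_S using bound that fin by (intro sum_strict_mono_ex1) auto
    also have "\<dots> \<le> 12 * t" using card by simp
    finally show False using S size_T by simp
  qed
  moreover have "\<F> \<noteq> {}" using S size_T \<open>0 < t\<close> by (metis mult_eq_0_iff not_less0 size_empty sum.empty zero_neq_numeral)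
  moreover have "4 \<le> ?v" using v \<open>0 < t\<close> by simp
  ultimately show ?thesis
    using F S gh by (simp add: is_CDF_iff)
qed

section \<open>Covering by differences\<close>

text \<open>Differences are invariant under translation, so a block is normalised to contain 0 and
  only its other three points are recorded, as integers not yet reduced modulo
  \<open>v\<close>.\<close>

type_synonym block = "int \<times> int \<times> int"

fun block_set :: "int \<Rightarrow> block \<Rightarrow> int set" where
  "block_set v (x, y, z) = {0, x mod v, y mod v, z mod v}"

fun block_diffs :: "block \<Rightarrow> int list" where
  "block_diffs (x, y, z) = [x, y, z, y - x, z - x, z - y]"

text \<open>\<open>block_diffs\<close> lists one difference per pair of points; the second disjunct
  supplies the opposite one.\<close>

definition covers :: "int \<Rightarrow> block set \<Rightarrow> int \<Rightarrow> bool" where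
  "covers v B d \<longleftrightarrow> (\<exists>b\<in>B. \<exists>\<delta>\<in>set (block_diffs b). v dvd d - \<delta> \<or> v dvd d + \<delta>)"

text \<open>Together with \<open>covers_minus\<close>, this moves every difference into the range
  from 0 to half the group order.\<close>

lemma covers_shift: "covers v B (k * v + d) \<longleftrightarrow> covers v B d"
proof -
  have "v dvd (k * v + d) - \<delta> \<longleftrightarrow> v dvd d - \<delta>" "v dvd (k * v + d) + \<delta> \<longleftrightarrow> v dvd d + \<delta>" for \<delta>
    by (simp_all add: add.assoc add_diff_eq[symmetric] dvd_add_right_iff)
  then show ?thesis unfolding covers_def by presburger
qed

lemma covers_minus: "covers v B (- d) \<longleftrightarrow> covers v B d"
proof -
  have "- d - \<delta> = - (d + \<delta>)" "- d + \<delta> = - (d - \<delta>)" for \<delta> by simp_all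
  then have "v dvd - d - \<delta> \<longleftrightarrow> v dvd d + \<delta>" "v dvd - d + \<delta> \<longleftrightarrow> v dvd d - \<delta>" for \<delta>
    by (metis dvd_minus_iff)+
  then show ?thesis unfolding covers_def by blast
qed

lemma mod_eq_if_dvd_diff:
  fixes d :: int
  assumes "0 \<le> d" "d < v" "v dvd d - (x - y)"
  shows "d = (x mod v - y mod v) mod v"
proof -
  have "d mod v = (x - y) mod v" using assms(3) by (simp add: mod_eq_dvd_iff)
  then show ?thesis using assms by (simp add: mod_diff_eq)
qed

text \<open>Differences come in opposite pairs, so the lower half of the residues suffices. By the
  counting argument of \<open>is_CDF_if_cover\<close>, neither distinctness of points nor
  disjointness of difference sets has to be checked.\<close>

lemma exists_CDF_if_covers:
  assumes gh: "0 < g" "0 < h" and v: "g * h = 12 * t + h" and "0 < t"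
    and B: "finite B" "card B \<le> t"
    and cover: "\<And>d. 0 < d \<Longrightarrow> 2 * d \<le> int (g * h) \<Longrightarrow> covers (int (g * h)) B d \<or> int g dvd d"
  shows "\<exists>\<F>. is_CDF g h 4 \<F>"
proof -
  let ?v = "int (g * h)" and ?F = "block_set (int (g * h)) ` B"
  have v0: "0 < ?v" using gh by simp
  have "is_CDF g h 4 ?F"
  proof (rule is_CDF_if_cover[OF gh v \<open>0 < t\<close>])
    show "finite ?F" using B by simp
    show "card ?F \<le> t" using card_image_le[OF B(1), of "block_set ?v"] B(2) by linarith
  next
    fix F assume "F \<in> ?F"
    then obtain x y z where F: "F = {0, x mod ?v, y mod ?v, z mod ?v}" by force
    have "card (set [0, x mod ?v, y mod ?v, z mod ?v]) \<le> 4"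
      by (rule order_trans[OF card_length]) simp
    then show "F \<subseteq> {0..<?v} \<and> card F \<le> 4" using v0 F by auto
  next
    fix d assume "d \<in> relative_residues g h"
    then have d: "0 \<le> d" "d < ?v" "\<not> int g dvd d" by (auto simp: relative_residues_def)
    then have "0 < d" by (cases "d = 0") auto
    have "covers ?v B d"
    proof (cases "2 * d \<le> ?v")
      case True then show ?thesis using cover \<open>0 < d\<close> d(3) by blast
    next
      case False
      \<comment> \<open>As \<open>g\<close> divides the group order, reflection preserves the
        complement of the subgroup.\<close>
      have "\<not> int g dvd ?v - d" using d(3) by (simp add: dvd_diff_right_iff)
      then have "covers ?v B (?v - d)" using cover[of "?v - d"] d False by auto
      then have "covers ?v B (1 * ?v + - d)" by simp
      then show ?thesis unfolding covers_shift covers_minus .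
    qed
    then obtain x y z \<delta> where b: "(x, y, z) \<in> B"
      and \<delta>: "\<delta> \<in> {x - 0, y - 0, z - 0, y - x, z - x, z - y}" "?v dvd d - \<delta> \<or> ?v dvd d + \<delta>"
      unfolding covers_def by force
    let ?P = "{0, x, y, z}"
    obtain p q where pq: "p \<in> ?P" "q \<in> ?P" "\<delta> = p - q" using \<delta>(1) by blast
    \<comment> \<open>The opposite sign amounts to exchanging \<open>p\<close> and
      \<open>q\<close>.\<close>
    have "?v dvd d - (p - q) \<or> ?v dvd d - (q - p)"
      using \<delta>(2) pq(3) by (simp add: algebra_simps)
    then obtain p q where pq: "p \<in> ?P" "q \<in> ?P" "?v dvd d - (p - q)" using pq by blast
    then have "p mod ?v \<in> block_set ?v (x, y, z)" "q mod ?v \<in> block_set ?v (x, y, z)" by auto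
    then have "\<exists>p\<in>block_set ?v (x, y, z). \<exists>q\<in>block_set ?v (x, y, z). d = (p - q) mod ?v"
      using mod_eq_if_dvd_diff[OF d(1,2) pq(3)] by blast
    then show "\<exists>F\<in>?F. \<exists>x\<in>F. \<exists>y\<in>F. d = (x - y) mod ?v" using b by blast
  qed
  then show ?thesis by blast
qed

section \<open>Checking explicit lists of blocks\<close>

text \<open>Bisection of the interval of length \<open>2 ^ k\<close> from \<open>d\<close>: the list
  is split along with the interval, so that each membership test sees a short list. The interval may
  overshoot the bound \<open>l\<close>; numbers beyond it pass.\<close>

fun covers_range :: "int \<Rightarrow> int \<Rightarrow> nat \<Rightarrow> int \<Rightarrow> int list \<Rightarrow> bool" where
  "covers_range g l 0 d ds \<longleftrightarrow> d \<in> set ds \<or> g dvd d \<or> l < d"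
| "covers_range g l (Suc k) d ds \<longleftrightarrow>
    (let m = d + 2 ^ k
     in covers_range g l k d (filter (\<lambda>x. x < m) ds) \<and> covers_range g l k m (filter (\<lambda>x. m \<le> x) ds))"

text \<open>The order is \<open>v\<close> and \<open>v div h\<close> is \<open>g\<close>. The bound
  512 makes \<open>v div 2\<close> smaller than \<open>2 ^ 8\<close>, so depth 8 reaches the whole
  lower half.\<close>

definition valid_blocks :: "int \<Rightarrow> block list \<Rightarrow> bool" where
  "valid_blocks h bs \<longleftrightarrow>
    (let v = 12 * int (length bs) + h
     in v < 512 \<and> covers_range (v div h) (v div 2) 8 0
          (map (\<lambda>x. if 2 * x \<le> v then x else v - x) (concat (map block_diffs bs))))"

lemma covers_range_sound:
  assumes "covers_range g l k d ds" "d \<le> x" "x < d + 2 ^ k" "x \<le> l"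
  shows "x \<in> set ds \<or> g dvd x"
  using assms
proof (induction k arbitrary: d ds)
  case (Suc k)
  then show ?case
    using Suc.IH[of d "filter (\<lambda>x. x < d + 2 ^ k) ds"]
      Suc.IH[of "d + 2 ^ k" "filter (\<lambda>x. d + 2 ^ k \<le> x) ds"]
    by (cases "x < d + 2 ^ k") (auto simp: Let_def)
qed auto

lemma exists_CDF_if_valid_blocks:
  assumes h: "0 < h" and gh: "0 < g" "g * h = 12 * length bs + h" "bs \<noteq> []"
    and valid: "valid_blocks (int h) bs"
  shows "\<exists>\<F>. is_CDF g h 4 \<F>"
proof (rule exists_CDF_if_covers[of g h "length bs" "set bs"])
  let ?v = "int (g * h)"
  let ?fold = "\<lambda>x. if 2 * x \<le> ?v then x else ?v - x"
  fix d assume d: "0 < d" "2 * d \<le> ?v"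
  have v: "12 * int (length bs) + int h = ?v" using gh(2) by simp
  have g: "?v div int h = int g" using h by simp
  have range: "?v < 512" "covers_range (int g) (?v div 2) 8 0 (map ?fold (concat (map block_diffs bs)))"
    using valid unfolding valid_blocks_def v Let_def g by auto
  have "d \<in> set (map ?fold (concat (map block_diffs bs))) \<or> int g dvd d"
    using range(1) d by (intro covers_range_sound[OF range(2)]) auto
  then show "covers ?v (set bs) d \<or> int g dvd d"
  proof
    assume "d \<in> set (map ?fold (concat (map block_diffs bs)))"
    then obtain b \<delta> where "b \<in> set bs" "\<delta> \<in> set (block_diffs b)" "d = ?fold \<delta>" by auto
    moreover from this have "?v dvd d - \<delta> \<or> ?v dvd d + \<delta>" by (auto split: if_splits)
    ultimately show ?thesis unfolding covers_def by blast
  qed simp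
qed (use h gh card_length in auto)

text \<open>The conjunction in the premise is what evaluating the data proves; with the lengths as
  an explicit list \<open>ks\<close>, only membership of \<open>t\<close> remains to be
  shown.\<close>

lemma exists_CDF_if_valid_small:
  assumes h: "0 < h" and gh: "g * h = 12 * t + h" and "0 < t"
    and bss: "list_all (valid_blocks (int h)) bss \<and> map (\<lambda>bs. int (length bs)) bss = ks"
      "int t \<in> set ks"
  shows "\<exists>\<F>. is_CDF g h 4 \<F>"
proof -
  obtain bs where bs: "bs \<in> set bss" "t = length bs" using bss by auto
  moreover have "0 < g" using gh h by (cases g) auto
  ultimately show ?thesis
    using exists_CDF_if_valid_blocks[of h g bs] h gh \<open>0 < t\<close> bss(1) by (auto simp: list_all_iff)
qed

section \<open>Linear families of blocks\<close>

text \<open>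
  A family \<open>(a, a', b, b', c, c', m)\<close> stands for the \<open>n + m\<close> blocks \<open>{0, X, X + Y, X + Y + Z}\<close> with
  \<open>X = a * n + a' + i\<close>, \<open>Y = b * n + b' + i\<close>, \<open>Z = c * n + c' + i\<close>; their differences form six
  arithmetic progressions with steps 1, 1, 1, 2, 2, 3. A progression \<open>(u, p, s, m)\<close> stands for the
  numbers \<open>u * n + p + s * i\<close> with \<open>0 \<le> i < n + m\<close>: it runs from near \<open>u * n\<close> to near \<open>(u + s) * n\<close>.
\<close>

type_synonym family = "int \<times> int \<times> int \<times> int \<times> int \<times> int \<times> int"
type_synonym progression = "int \<times> int \<times> int \<times> int"

fun family_blocks :: "int \<Rightarrow> family \<Rightarrow> block list" where
  "family_blocks n (a, a', b, b', c, c', m) =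
    map (\<lambda>i. let x = a * n + a' + i; y = x + (b * n + b' + i) in (x, y, y + (c * n + c' + i))) [0..n + m - 1]"

fun progressions :: "family \<Rightarrow> progression list" where
  "progressions (a, a', b, b', c, c', m) =
    [(a, a', 1, m), (b, b', 1, m), (c, c', 1, m),
     (a + b, a' + b', 2, m), (b + c, b' + c', 2, m), (a + b + c, a' + b' + c', 3, m)]"

text \<open>The order of the group is \<open>72 * n + w\<close>; normal progressions run between 0 and half of it.\<close>

fun normal_progression :: "int \<Rightarrow> progression \<Rightarrow> progression" where
  "normal_progression w (u, p, s, m) =
    (let u' = u mod 72; p' = p - u div 72 * w
     in if u' < 36 then (u', p', s, m) else (72 - u' - s, w - p' - s * (m - 1), s, m))"

text \<open>The points are affine in \<open>n\<close>, hence so are their differences; a pair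
  \<open>(u, y)\<close> in \<open>points\<close> stands for \<open>u * n + y\<close>.\<close>

type_synonym fixed_block = "int \<times> int \<times> int \<times> int \<times> int \<times> int"

fun fixed_block :: "int \<Rightarrow> fixed_block \<Rightarrow> block" where
  "fixed_block n (a, a', b, b', c, c') = (a * n + a', b * n + b', c * n + c')"

fun points :: "fixed_block \<Rightarrow> (int \<times> int) list" where
  "points (a, a', b, b', c, c') =
    [(a, a'), (b, b'), (c, c'), (b - a, b' - a'), (c - a, c' - a'), (c - b, c' - b')]"

text \<open>Points above half the order are reflected. For \<open>u = 36\<close> the point is close
  to the middle, so both it and its mirror image are kept.\<close>

fun normal_points :: "int \<Rightarrow> int \<times> int \<Rightarrow> (int \<times> int) list" where
  "normal_points w (u, y) =
    (if u < 36 then [(u, y)] else if u = 36 then [(u, y), (u, w - y)] else [(72 - u, w - y)])"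

text \<open>Tests whether \<open>u * n + z\<close> is a term near the beginning or near the end of
  the progression, whose last term is \<open>(u' + s) * n + p + s * (m - 1)\<close>. Bounding the
  index with \<open>n\<^sub>0\<close> in place of \<open>n\<close> makes the test independent of
  \<open>n\<close> and valid for all larger \<open>n\<close>.\<close>

fun hit :: "int \<Rightarrow> progression \<Rightarrow> int \<Rightarrow> int \<Rightarrow> bool" where
  "hit n\<^sub>0 (u', p, s, m) u z \<longleftrightarrow>
    u = u' \<and> p \<le> z \<and> s dvd z - p \<and> z - p < s * (n\<^sub>0 + m) \<or>
    u = u' + s \<and> z \<le> p + s * (m - 1) \<and> s dvd p + s * (m - 1) - z \<and> p + s * (m - 1) - z < s * (n\<^sub>0 + m)"

definition hit_list :: "int \<Rightarrow> progression list \<Rightarrow> (int \<times> int) list \<Rightarrow> int \<Rightarrow> int list \<Rightarrow> bool" where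
  "hit_list n\<^sub>0 ps ts u zs =
    list_all (\<lambda>z. (u, z) \<in> set ts \<or> list_ex (\<lambda>p. hit n\<^sub>0 p u z) ps) zs"

text \<open>
  Walks through the numbers from \<open>u * n + y\<close> to \<open>36 * n + l\<close>: close to a multiple of \<open>n\<close> every number is
  looked up individually, and in between \<open>s\<close> progressions of step \<open>s\<close> starting near \<open>u * n\<close>
  cover everything.
\<close>

fun tiled :: "int \<Rightarrow> progression list \<Rightarrow> (int \<times> int) list \<Rightarrow> int \<Rightarrow> int \<Rightarrow> int \<Rightarrow> int list \<Rightarrow> bool" where
  "tiled n\<^sub>0 ps ts l u y [] \<longleftrightarrow> u = 36 \<and> hit_list n\<^sub>0 ps ts u [y..l]"
| "tiled n\<^sub>0 ps ts l u y (s # ss) \<longleftrightarrow>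
    (let qs = filter (\<lambda>(u', p, s', m). u' = u \<and> s' = s) ps;
         lo = Max (set (map (\<lambda>(u', p, s', m). p - s + 1) qs));
         hi = Min (set (map (\<lambda>(u', p, s', m). p + s * m - 1) qs))
     in 0 < s \<and> hit_list n\<^sub>0 ps ts u [y..lo - 1] \<and>
        list_all (\<lambda>j. list_ex (\<lambda>(u', p, s', m). p mod s = j) qs) [0..s - 1] \<and>
        tiled n\<^sub>0 ps ts l (u + s) (hi + 1) ss)"

lemma hit_sound:
  assumes "hit n\<^sub>0 (u', p, s, m) u z" "n\<^sub>0 \<le> n" "0 < s"
  shows "\<exists>i. 0 \<le> i \<and> i < n + m \<and> u * n + z = u' * n + p + s * i"
proof -
  have le: "s * (n\<^sub>0 + m) \<le> s * (n + m)" using assms by simp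
  consider k where "u = u'" "p \<le> z" "z - p = s * k" "z - p < s * (n\<^sub>0 + m)"
    | k where "u = u' + s" "z \<le> p + s * (m - 1)" "p + s * (m - 1) - z = s * k"
        "p + s * (m - 1) - z < s * (n\<^sub>0 + m)"
    using assms(1) unfolding hit.simps dvd_def by blast
  then show ?thesis
  proof cases
    case 1
    then have "0 \<le> s * k" "s * k < s * (n + m)" using le by linarith+
    then have "0 \<le> k" "k < n + m" using assms(3) by (auto simp: zero_le_mult_iff)
    then show ?thesis using 1 by (intro exI[of _ k]) auto
  next
    case 2
    then have "0 \<le> s * k" "s * k < s * (n + m)" using le by linarith+
    then have "0 \<le> k" "k < n + m" using assms(3) by (auto simp: zero_le_mult_iff)
    \<comment> \<open>In this case \<open>k\<close> counts backwards from the last term, which has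
      index \<open>n + m - 1\<close>.\<close>
    moreover have "(u' + s) * n + z = u' * n + p + s * (n + m - 1 - k)"
      using 2(3) by (simp add: algebra_simps)
    ultimately show ?thesis using 2(1) by (intro exI[of _ "n + m - 1 - k"]) auto
  qed
qed

text \<open>Induction over the steps: each one passes from the vicinity of \<open>u * n\<close> to
  that of \<open>(u + s) * n\<close>. The property \<open>Q\<close> is later instantiated with being
  covered or lying in the subgroup.\<close>

lemma tiled_sound:
  assumes "tiled n\<^sub>0 ps ts l u y ss" "n\<^sub>0 \<le> n"
    and ps: "\<And>u p s m i. (u, p, s, m) \<in> set ps \<Longrightarrow> 0 < s \<and> (0 \<le> i \<and> i < n + m \<longrightarrow> Q (u * n + p + s * i))"
    and ts: "\<And>u z. (u, z) \<in> set ts \<Longrightarrow> Q (u * n + z)"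
    and "u * n + y \<le> x" "x \<le> 36 * n + l"
  shows "Q x"
proof -
  have hit: "Q (u * n + z)" if "hit_list n\<^sub>0 ps ts u zs" "z \<in> set zs" for u z zs
  proof -
    from that consider "(u, z) \<in> set ts" | p where "p \<in> set ps" "hit n\<^sub>0 p u z"
      by (auto simp: hit_list_def list_all_iff list_ex_iff)
    then show ?thesis
    proof cases
      case 2
      obtain u' q s m where p: "p = (u', q, s, m)" by (cases p)
      show ?thesis
        using hit_sound[of n\<^sub>0 u' q s m u z n] ps[of u' q s m] 2 p \<open>n\<^sub>0 \<le> n\<close> by fastforce
    qed (rule ts)
  qed
  show ?thesis using assms(1,5,6)
  proof (induction ss arbitrary: u y)
    case Nil
    then show ?case using hit[of 36 "[y..l]" "x - 36 * n"] by auto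
  next
    case (Cons s ss)
    define qs where "qs = filter (\<lambda>(u', p, s', m). u' = u \<and> s' = s) ps"
    define lo where "lo = Max (set (map (\<lambda>(u', p, s', m). p - s + 1) qs))"
    define hi where "hi = Min (set (map (\<lambda>(u', p, s', m). p + s * m - 1) qs))"
    from Cons.prems(1) have *: "0 < s" "hit_list n\<^sub>0 ps ts u [y..lo - 1]"
      "\<And>j. 0 \<le> j \<Longrightarrow> j < s \<Longrightarrow> \<exists>(u', p, s', m) \<in> set qs. p mod s = j"
      "tiled n\<^sub>0 ps ts l (u + s) (hi + 1) ss"
      by (auto simp: qs_def lo_def hi_def Let_def list_all_iff list_ex_iff)
    \<comment> \<open>Near \<open>u * n\<close> single lookups apply, in the middle the full set of
      residues modulo \<open>s\<close>, and beyond it the induction hypothesis.\<close>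
    consider "x < u * n + lo" | "u * n + lo \<le> x" "x \<le> (u + s) * n + hi" | "(u + s) * n + hi < x"
      by linarith
    then show ?case
    proof cases
      case 1
      then show ?thesis using hit[OF *(2), of "x - u * n"] Cons.prems by auto
    next
      case 2
      have "0 \<le> (x - u * n) mod s" "(x - u * n) mod s < s" using *(1) by auto
      from *(3)[OF this] obtain p m where q: "(u, p, s, m) \<in> set qs" "p mod s = (x - u * n) mod s"
        by (auto simp: qs_def)
      \<comment> \<open>The interval may extend \<open>s - 1\<close> past either end of the
        progression: \<open>x\<close> is congruent to its terms modulo \<open>s\<close>, and a
        multiple of \<open>s\<close> greater than \<open>- s\<close> is nonnegative; the upper end
        is analogous.\<close>
      have "lo \<ge> p - s + 1" unfolding lo_def using q(1) by (intro Max_ge) force+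
      moreover have "hi \<le> p + s * m - 1" unfolding hi_def using q(1) by (intro Min_le) force+
      moreover obtain k where k: "x - u * n - p = s * k"
        using q(2) by (metis dvdE mod_eq_dvd_iff)
      ultimately have "s * (- 1) < s * k" "s * k < s * (n + m)"
        using 2 by (simp_all add: algebra_simps)
      then have "- 1 < k" "k < n + m" using *(1) unfolding mult_less_cancel_left_pos[OF *(1)] by simp_all
      then have "0 \<le> k" "k < n + m" by simp_all
      moreover have "(u, p, s, m) \<in> set ps" using q(1) by (simp add: qs_def)
      ultimately have "Q (u * n + p + s * k)" using ps by blast
      then show ?thesis using k by (simp add: algebra_simps)
    next
      case 3
      then show ?thesis using Cons.IH[OF *(4)] Cons.prems by auto
    qed
  qed
qed

section \<open>Tables and their validity for all large \<open>n\<close>\<close>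

type_synonym table = "int \<times> family list \<times> fixed_block list \<times> int list"

text \<open>
  The multiples of the subgroup generator \<open>g\<close> up to half the group order, for \<open>g * h = 72 * n + w\<close>.
\<close>

definition multiples :: "int \<Rightarrow> int \<Rightarrow> (int \<times> int) list" where
  "multiples h w = map (\<lambda>k. (72 * k div h, w * k div h)) [1..h div 2]"

text \<open>The table serves \<open>t = 6 * n + r\<close>, so the order is \<open>72 * n + w\<close>
  with \<open>w = 12 * r + h\<close>, and \<open>36 * n + 6 * r + h div 2\<close> is half of it,
  rounded down. The two equations on lengths make the number of blocks exactly
  \<open>t\<close>.\<close>

fun valid_table :: "int \<Rightarrow> int \<Rightarrow> table \<Rightarrow> bool" where
  "valid_table h n\<^sub>0 (r, fs, bs, ss) \<longleftrightarrow>
    length fs = 6 \<and> list_all (\<lambda>(a, a', b, b', c, c', m). 0 \<le> n\<^sub>0 + m) fs \<and>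
    sum_list (map (\<lambda>(a, a', b, b', c, c', m). m) fs) + int (length bs) = r \<and>
    tiled n\<^sub>0 (map (normal_progression (12 * r + h)) (concat (map progressions fs)))
      (multiples h (12 * r + h) @ concat (map (normal_points (12 * r + h)) (concat (map points bs))))
      (6 * r + h div 2) 0 1 ss"

lemma covers_progression:
  assumes "(u, p, s, m) \<in> set (progressions f)" "0 \<le> i" "i < n + m"
    and "set (family_blocks n f) \<subseteq> B"
  shows "covers v B (u * n + p + s * i)"
proof -
  obtain a a' b b' c c' m' where f: "f = (a, a', b, b', c, c', m')" by (cases f)
  let ?x = "a * n + a' + i" and ?y = "b * n + b' + i" and ?z = "c * n + c' + i"
  have "m' = m" using assms(1) f by auto
  then have "i \<in> set [0..n + m' - 1]" using assms(2,3) by simp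
  then have mem: "(?x, ?x + ?y, ?x + ?y + ?z) \<in> B"
    using assms(4) unfolding f by (auto simp: Let_def)
  have "u * n + p + s * i \<in> set (block_diffs (?x, ?x + ?y, ?x + ?y + ?z))"
    using assms(1) f by (auto simp: algebra_simps)
  with mem show ?thesis unfolding covers_def by force
qed

text \<open>Removing \<open>u div 72\<close> copies of the order moves the start to
  \<open>u mod 72\<close>. If that is at least 36, the progression is reflected, which reverses it:
  its last term, near \<open>(u mod 72 + s) * n\<close>, becomes the first.\<close>

lemma covers_normal_progression:
  assumes "\<And>i. 0 \<le> i \<Longrightarrow> i < n + m \<Longrightarrow> covers (72 * n + w) B (u * n + p + s * i)"
    and "normal_progression w (u, p, s, m) = (u', p', s', m')" "0 \<le> i" "i < n + m'"
  shows "covers (72 * n + w) B (u' * n + p' + s' * i)"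
proof -
  let ?v = "72 * n + w" and ?k = "u div 72"
  have u: "u * n = 72 * ?k * n + u mod 72 * n" by (metis distrib_right mult_div_mod_eq)
  have *: "covers ?v B (u mod 72 * n + (p - ?k * w) + s * j)" if "0 \<le> j" "j < n + m" for j
  proof -
    have "u * n + p + s * j = ?k * ?v + (u mod 72 * n + (p - ?k * w) + s * j)"
      by (simp only: u) (simp add: algebra_simps)
    then show ?thesis using assms(1)[OF that] covers_shift by metis
  qed
  show ?thesis
  proof (cases "u mod 72 < 36")
    case True
    then have "u' = u mod 72" "p' = p - ?k * w" "s' = s" "m' = m"
      using assms(2) by (auto simp: Let_def)
    then show ?thesis using *[of i] assms(3,4) by simp
  next
    case False
    then have eq: "u' = 72 - u mod 72 - s" "p' = w - (p - ?k * w) - s * (m - 1)" "s' = s" "m' = m"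
      using assms(2) by (auto simp: Let_def)
    have "u' * n + p' + s' * i = 1 * ?v + - (u mod 72 * n + (p - ?k * w) + s * (n + m - 1 - i))"
      unfolding eq by (simp add: algebra_simps)
    moreover have "covers ?v B (u mod 72 * n + (p - ?k * w) + s * (n + m - 1 - i))"
      using assms(3,4) eq by (intro *) auto
    ultimately show ?thesis by (simp only: covers_shift covers_minus)
  qed
qed

lemma covers_points:
  assumes "(u, y) \<in> set (points b)" "fixed_block n b \<in> B"
  shows "covers v B (u * n + y)"
proof -
  obtain a a' c c' d d' where b: "b = (a, a', c, c', d, d')" by (cases b)
  have "u * n + y \<in> set (block_diffs (fixed_block n b))"
    using assms(1) unfolding b by (auto simp: algebra_simps)
  with assms(2) show ?thesis unfolding covers_def by force
qed

lemma covers_normal_points: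
  assumes "covers (72 * n + w) B (u * n + y)" "(u', y') \<in> set (normal_points w (u, y))"
  shows "covers (72 * n + w) B (u' * n + y')"
proof -
  have "covers (72 * n + w) B (1 * (72 * n + w) + - (u * n + y))"
    using assms(1) by (simp only: covers_shift covers_minus)
  then have "covers (72 * n + w) B ((72 - u) * n + (w - y))" by (simp add: algebra_simps)
  then show ?thesis using assms by (auto split: if_splits)
qed

text \<open>\<open>k * g\<close> equals \<open>(72 * n + 12 * r + h) * k / h\<close>. Since
  \<open>h\<close> divides 12, both the part with \<open>n\<close> and the offset are divisible by
  \<open>h\<close> separately.\<close>

lemma dvd_multiples:
  assumes "h \<in> {2, 3, 6}" "g * h = 72 * n + 12 * r + h" "(u, y) \<in> set (multiples h (12 * r + h))"
  shows "(g :: int) dvd u * n + y"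
proof -
  obtain k where k: "u = 72 * k div h" "y = (12 * r + h) * k div h"
    using assms(3) by (auto simp: multiples_def)
  have "h dvd 72 * k" "h dvd (12 * r + h) * k" using assms(1) by auto
  then have "h * u = 72 * k" "h * y = (12 * r + h) * k" using k by simp_all
  then have "h * (u * n + y) = 72 * k * n + (12 * r + h) * k"
    by (metis distrib_left mult.assoc)
  also have "\<dots> = (72 * n + 12 * r + h) * k" by (simp add: algebra_simps)
  also have "\<dots> = h * (g * k)" by (simp flip: assms(2))
  finally have "h * (u * n + y) = h * (g * k)" .
  then show ?thesis using assms(1) by auto
qed

lemma exists_CDF_if_valid_table:
  assumes h: "h \<in> {2, 3, 6}" and gh: "0 < g" "int (g * h) = 72 * n + 12 * r + int h"
    and valid: "valid_table (int h) n\<^sub>0 (r, fs, bs, ss)"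
    and n: "n\<^sub>0 \<le> n" "0 < 6 * n + r"
  shows "\<exists>\<F>. is_CDF g h 4 \<F>"
proof -
  let ?w = "12 * r + int h"
  let ?v = "72 * n + ?w"
  define bl where "bl = concat (map (family_blocks n) fs) @ map (fixed_block n) bs"
  \<comment> \<open>The index list \<open>[0..n + m - 1]\<close> has length \<open>n + m\<close>
    only if this is nonnegative, hence the condition on \<open>n\<^sub>0 + m\<close>.\<close>
  have len: "int (length (concat (map (family_blocks n) fs))) =
      n * int (length fs) + sum_list (map (\<lambda>(a, a', b, b', c, c', m). m) fs)"
    if "list_all (\<lambda>(a, a', b, b', c, c', m). 0 \<le> n\<^sub>0 + m) fs"
    using that n(1) by (induction fs) (auto simp: algebra_simps)
  have lbl: "int (length bl) = 6 * n + r"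
    using len valid by (simp add: bl_def)
  have v: "int (g * h) = ?v" using gh(2) by simp
  have "covers ?v (set bl) x \<or> int g dvd x" if x: "1 \<le> x" "2 * x \<le> ?v" for x
  proof (rule tiled_sound[where Q = "\<lambda>x. covers ?v (set bl) x \<or> int g dvd x"])
    let ?ps = "concat (map progressions fs)" and ?ts = "concat (map points bs)"
    show "tiled n\<^sub>0 (map (normal_progression ?w) ?ps)
      (multiples (int h) ?w @ concat (map (normal_points ?w) ?ts)) (6 * r + int h div 2) 0 1 ss"
      using valid by simp
    show "n\<^sub>0 \<le> n" by fact
    show "0 * n + 1 \<le> x" using x by simp
    show "x \<le> 36 * n + (6 * r + int h div 2)" using x by linarith
  next
    fix u y assume "(u, y) \<in> set (multiples (int h) ?w @
      concat (map (normal_points ?w) (concat (map points bs))))"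
    then consider "(u, y) \<in> set (multiples (int h) ?w)"
      | b u' y' where "b \<in> set bs" "(u', y') \<in> set (points b)" "(u, y) \<in> set (normal_points ?w (u', y'))"
      by (auto simp del: normal_points.simps points.simps)
    then show "covers ?v (set bl) (u * n + y) \<or> int g dvd u * n + y"
    proof cases
      case 1
      then show ?thesis using dvd_multiples[of "int h" "int g" n r u y] h gh(2) by auto
    next
      case 2
      then have "fixed_block n b \<in> set bl" by (simp add: bl_def)
      with 2(2) have "covers ?v (set bl) (u' * n + y')" by (rule covers_points)
      then show ?thesis using covers_normal_points 2(3) by blast
    qed
  next
    fix u p s m i
    assume "(u, p, s, m) \<in> set (map (normal_progression ?w) (concat (map progressions fs)))"
    then obtain f q where f: "f \<in> set fs" "q \<in> set (progressions f)"
      and q: "normal_progression ?w q = (u, p, s, m)"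
      by (auto simp del: normal_progression.simps progressions.simps)
    obtain u' p' s' m' where q': "q = (u', p', s', m')" by (cases q)
    have "set (family_blocks n f) \<subseteq> set bl" using f(1) by (auto simp: bl_def)
    then have *: "covers ?v (set bl) (u' * n + p' + s' * j)" if "0 \<le> j" "j < n + m'" for j
      using covers_progression[OF f(2)[unfolded q'] that] by blast
    have "covers ?v (set bl) (u * n + p + s * i)" if "0 \<le> i" "i < n + m"
      by (rule covers_normal_progression[OF * q[unfolded q'] that])
    moreover have "s' = s" using q unfolding q' by (auto simp: Let_def split: if_splits)
    moreover have "0 < s'" using f(2) unfolding q' by (cases f) auto
    ultimately show "0 < s \<and> (0 \<le> i \<and> i < n + m \<longrightarrow>
        covers ?v (set bl) (u * n + p + s * i) \<or> int g dvd u * n + p + s * i)"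
      by blast
  qed
  then have "covers (int (g * h)) (set bl) d \<or> int g dvd d" if "0 < d" "2 * d \<le> int (g * h)" for d
    using that unfolding v by auto
  moreover have "g * h = 12 * nat (6 * n + r) + h" using gh(2) n(2) by linarith
  moreover have "card (set bl) \<le> nat (6 * n + r)" using card_length[of bl] lbl by linarith
  ultimately show ?thesis
    using exists_CDF_if_covers[of g h "nat (6 * n + r)" "set bl"] gh(1) h n(2) by auto
qed

text \<open>If \<open>27 \<le> t = 6 * n + r\<close> then \<open>n\<close> is at least the rounded up quotient of \<open>27 - r\<close> by 6.\<close>

definition valid_tables :: "int \<Rightarrow> table list \<Rightarrow> bool" where
  "valid_tables h ts \<longleftrightarrow>
    list_all (\<lambda>T. valid_table h ((32 - fst T) div 6) T) ts \<and> map (\<lambda>T. fst T mod 6) ts = [0..5]"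

text \<open>The values of \<open>r\<close> represent all classes modulo 6, some by negative numbers,
  so every \<open>t\<close> is \<open>6 * n + r\<close> for one of the tables.\<close>

lemma exists_CDF_if_valid_tables:
  assumes h: "h \<in> {2, 3, 6}" and gh: "g * h = 12 * t + h" and t: "27 \<le> t"
    and valid: "valid_tables (int h) ts"
  shows "\<exists>\<F>. is_CDF g h 4 \<F>"
proof -
  have "int t mod 6 \<in> set (map (\<lambda>T. fst T mod 6) ts)"
    using valid unfolding valid_tables_def by simp
  then obtain r fs bs ss where T: "(r, fs, bs, ss) \<in> set ts" "r mod 6 = int t mod 6"
    by auto
  define n where "n = (int t - r) div 6"
  have n: "6 * n + r = int t" unfolding n_def using T(2) by presburger
  have "(32 - r) div 6 \<le> n" using n t by linarith
  moreover have "valid_table (int h) ((32 - r) div 6) (r, fs, bs, ss)"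
    using valid T(1) unfolding valid_tables_def list_all_iff by fastforce
  moreover have "0 < g" using gh h by (cases g) auto
  moreover have "int (g * h) = 72 * n + 12 * r + int h" unfolding gh using n by linarith
  ultimately show ?thesis
    using exists_CDF_if_valid_table[OF h, of g n r] n t by simp
qed

section \<open>Tables\<close>

text \<open>
  The data below were found by computer search: first the multiples of \<open>n\<close> at which the progressions
  start, from a tiling of 36 cells by six families, and then the offsets and the fixed blocks.
\<close>

definition tables_2 :: "table list" where
  "tables_2 = [
   (0,
     [(3, 1, 52, 3, 49, 2, -1), (5, -1, 18, 2, 46, 2, -1), (8, 0, 21, 2, 40, 3, -3),
     (11, 4, 4, 1, 54, 5, -2), (14, 3, 44, 4, 51, 4, -3), (26, 3, 35, 1, 43, 4, -1)],
     [(0, 6, 9, 3, 31, 2), (14, -3, 28, -1, 51, 3), (3, -5, 14, -2, 18, -2), (0, 3, 6, 1, 32, 3),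
     (0, 2, 9, 0, 31, 0), (6, -1, 29, 1, 43, 2), (3, 0, 14, 0, 54, 1), (9, -1, 18, 0, 29, -1),
     (3, -2, 18, -1, 50, 1), (11, 1, 25, 0, 36, 2), (6, 0, 21, 0, 52, 1)],
     [3, 1, 1, 1, 2, 1, 2, 1, 2, 1, 2, 1, 1, 1, 1, 1, 1, 2, 1, 1, 1, 1, 2, 1, 3, 1]),
   (1,
     [(3, 1, 11, 3, 55, 10, -1), (6, 3, 26, 5, 40, 11, -2), (9, 4, 47, 9, 37, 12, -2),
     (10, 3, 8, 4, 30, 7, -1), (17, 6, 25, 6, 27, 4, -1), (20, 5, 64, 15, 36, 10, -3)],
     [(6, 0, 27, 3, 34, 4), (4, 3, 12, 5, 21, 8), (0, 1, 0, 3, 37, 11), (12, 3, 24, 7, 48, 8),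
     (7, 2, 28, 9, 44, 11), (11, 2, 32, 4, 48, 9), (3, -1, 21, 5, 51, 10), (4, 0, 18, 5, 32, 5),
     (6, 2, 14, 3, 42, 10), (4, 1, 8, 3, 16, 3), (10, 2, 24, 4, 40, 8)],
     [3, 1, 2, 1, 1, 1, 1, 1, 1, 2, 2, 1, 1, 2, 1, 3, 1, 1, 1, 1, 2, 1, 1, 2, 1, 1]),
   (2,
     [(3, 2, 30, 11, 59, 22, -1), (6, 4, 7, 5, 36, 15, -1), (9, 4, 8, 6, 52, 21, -2),
     (15, 6, 31, 15, 26, 11, -2), (16, 4, 66, 28, 39, 16, -2), (23, 9, 4, 2, 42, 16, -1)],
     [(3, -2, 29, 8, 39, 10), (3, 0, 15, 2, 23, 7), (3, 1, 15, 4, 27, 9), (4, 1, 33, 12, 41, 16),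
     (6, -1, 19, 6, 26, 9), (7, 4, 17, 8, 60, 25), (6, 1, 26, 7, 39, 12), (10, 3, 29, 10, 41, 14),
     (0, 1, 24, 10, 41, 13), (0, 3, 6, 3, 55, 24), (0, 2, 17, 6, 23, 8)],
     [3, 1, 1, 1, 1, 1, 1, 1, 2, 1, 2, 1, 1, 2, 1, 3, 1, 2, 1, 2, 1, 1, 1, 1, 2, 1]),
   (-3,
     [(3, 1, 10, -5, 56, -25, -2), (12, -5, 20, -8, 46, -19, -2), (16, -6, 11, -4, 36, -13, -3),
     (17, -6, 30, -14, 22, -10, -2), (21, -8, 31, -15, 26, -8, -2), (29, -11, 9, -3, 34, -14, -3)],
     [(0, 3, 6, 0, 63, -26), (0, 2, 32, -14, 36, -14), (10, -6, 25, -15, 46, -25),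
     (11, -7, 29, -15, 54, -28), (3, -1, 16, -8, 59, -28), (6, -2, 29, -12, 40, -17),
     (3, 0, 18, -7, 41, -18), (12, -7, 29, -16, 46, -24), (0, 1, 26, -13, 46, -22),
     (3, -3, 6, -5, 66, -33), (11, -6, 32, -15, 49, -22)],
     [3, 1, 2, 3, 1, 1, 1, 1, 2, 1, 1, 1, 2, 1, 1, 1, 2, 1, 1, 2, 1, 1, 1, 2, 1, 1]),
   (-2,
     [(3, 2, 10, -2, 56, -16, -4), (11, -3, 16, -2, 36, -10, -2), (12, -3, 20, -5, 46, -14, -1),
     (17, -3, 30, -9, 22, -6, -1), (21, -5, 26, -6, 31, -7, -3), (29, -8, 9, -1, 34, -9, -2)],
     [(0, 6, 4, 4, 15, -2), (0, 3, 4, 2, 15, -3), (6, -2, 15, -7, 21, -6),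
     (6, -1, 23, -5, 43, -13), (3, 1, 16, -3, 43, -12), (3, -1, 23, -7, 50, -14),
     (4, 0, 31, -8, 42, -12), (0, 1, 3, -2, 16, -4), (3, 0, 13, -3, 60, -17),
     (9, -4, 34, -11, 46, -15), (9, -3, 31, -10, 40, -12)],
     [3, 1, 2, 3, 1, 1, 1, 1, 2, 1, 1, 1, 2, 1, 1, 1, 2, 1, 1, 2, 1, 1, 1, 2, 1, 1]),
   (-1,
     [(3, 3, 10, 2, 56, -7, -3), (6, 1, 7, 1, 23, -2, -2), (9, -1, 50, -4, 49, -6, -2),
     (16, 1, 24, -1, 29, -4, -2), (19, 0, 8, -1, 45, -7, -1), (25, -2, 51, -6, 32, -4, -2)],
     [(3, -5, 13, -4, 16, -2), (3, -1, 7, 0, 39, -8), (9, -2, 24, -4, 57, -10),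
     (4, 0, 11, -1, 26, -2), (3, -2, 13, -2, 16, -1), (6, -2, 19, -3, 25, -3),
     (6, -3, 22, -3, 48, -7), (3, -3, 30, -5, 36, -6), (3, 0, 13, -3, 26, -3),
     (0, 1, 17, 0, 39, -5), (10, -2, 32, -6, 42, -7)],
     [3, 1, 2, 1, 1, 1, 1, 1, 2, 2, 1, 1, 2, 1, 1, 1, 1, 1, 1, 1, 1, 2, 1, 2, 1, 3])]"

lemma valid_tables_2: "valid_tables 2 tables_2"
  by code_simp

definition tables_3 :: "table list" where
  "tables_3 = [
   (0,
     [(3, 3, 11, 1, 55, 5, -2), (6, 2, 26, 2, 40, 3, -1), (9, 1, 47, 3, 37, 2, -1),
     (10, 1, 8, 2, 30, 2, -1), (17, 2, 25, 2, 27, 3, -2), (20, 2, 64, 2, 36, 3, -4)],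
     [(7, 5, 21, -2, 42, 9), (7, 4, 21, -1, 42, 7), (7, 3, 21, 0, 42, 5), (0, 2, 3, -1, 17, 1),
     (0, 1, 3, 2, 27, 2), (7, 2, 18, 2, 58, 4), (7, 1, 25, 1, 51, 1), (3, 0, 20, 0, 34, 1),
     (4, 1, 16, 0, 58, 3), (6, 0, 26, 1, 36, 1), (6, -1, 12, 0, 40, 1)],
     [3, 1, 2, 1, 1, 1, 1, 1, 1, 2, 2, 1, 1, 2, 1, 3, 1, 1, 1, 1, 2, 1, 1, 2, 1, 1]),
   (1,
     [(3, 2, 10, 3, 56, 14, -1), (6, 3, 7, 7, 23, 8, -3), (9, 4, 50, 12, 49, 12, -2),
     (16, 4, 24, 7, 29, 7, -2), (19, 4, 8, 4, 45, 11, -1), (25, 7, 51, 11, 32, 8, -1)],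
     [(6, 2, 13, 8, 36, 15), (6, 1, 13, 6, 36, 12), (3, 1, 24, 6, 30, 6), (0, 1, 7, 1, 7, 4),
     (4, 1, 17, 2, 47, 10), (3, 0, 19, 2, 55, 12), (9, 3, 25, 6, 36, 9), (11, 2, 30, 5, 50, 10),
     (3, -1, 20, 4, 33, 8), (7, 2, 30, 7, 43, 10), (10, 2, 23, 4, 50, 11)],
     [3, 1, 2, 1, 1, 1, 1, 1, 2, 2, 1, 1, 2, 1, 1, 1, 1, 1, 1, 1, 1, 2, 1, 2, 1, 3]),
   (2,
     [(3, 2, 11, 7, 55, 24, -2), (6, 5, 26, 9, 40, 15, 0), (9, 6, 47, 19, 37, 17, -3),
     (10, 6, 8, 5, 30, 11, -1), (17, 9, 25, 11, 27, 12, -2), (20, 11, 64, 24, 36, 15, -1)],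
     [(3, -2, 24, 10, 40, 14), (4, 3, 10, 3, 64, 23), (3, -3, 6, -2, 61, 21),
     (3, 0, 9, 4, 63, 22), (12, 6, 28, 11, 48, 19), (4, 0, 18, 8, 52, 21),
     (11, 5, 28, 10, 48, 20), (6, 2, 20, 9, 47, 18), (0, 1, 17, 8, 42, 18), (4, 1, 14, 5, 41, 15),
     (10, 5, 24, 11, 55, 21)],
     [3, 1, 2, 1, 1, 1, 1, 1, 1, 2, 2, 1, 1, 2, 1, 3, 1, 1, 1, 1, 2, 1, 1, 2, 1, 1]),
   (-3,
     [(3, -1, 30, -13, 59, -25, -2), (6, -5, 7, -2, 36, -16, -1), (9, -3, 8, -3, 52, -22, -2),
     (15, -4, 31, -13, 26, -10, -3), (16, -7, 66, -27, 39, -15, -3), (23, -8, 4, 0, 42, -18, -3)],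
     [(0, 2, 7, -4, 39, -20), (3, -4, 23, -14, 52, -26), (0, 3, 15, -6, 57, -25),
     (4, -3, 17, -7, 43, -19), (4, -1, 27, -10, 39, -17), (5, -3, 15, -7, 46, -22),
     (0, 1, 3, -2, 48, -23), (9, -5, 26, -14, 35, -18), (4, -2, 23, -12, 43, -20),
     (7, -5, 17, -10, 62, -30), (7, -3, 19, -9, 59, -27)],
     [3, 1, 1, 1, 1, 1, 1, 1, 2, 1, 2, 1, 1, 2, 1, 3, 1, 2, 1, 2, 1, 1, 1, 1, 2, 1]),
   (-2,
     [(3, 0, 30, -9, 59, -15, -4), (6, 0, 7, -2, 36, -8, -2), (9, -2, 8, -2, 52, -13, -2),
     (15, -2, 31, -10, 26, -6, -1), (16, -3, 66, -19, 39, -10, -2), (23, -5, 4, -1, 42, -10, -2)],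
     [(4, -4, 23, -15, 35, -17), (4, -3, 23, -12, 35, -15), (0, 2, 10, -2, 53, -13),
     (3, -2, 23, -9, 36, -12), (9, -4, 19, -7, 32, -11), (4, -2, 30, -10, 35, -13),
     (0, 1, 5, -1, 64, -17), (9, -3, 24, -6, 36, -10), (5, 0, 20, -4, 37, -9),
     (6, -1, 26, -7, 49, -13), (3, -1, 15, -6, 35, -11)],
     [3, 1, 1, 1, 1, 1, 1, 1, 2, 1, 2, 1, 1, 2, 1, 3, 1, 2, 1, 2, 1, 1, 1, 1, 2, 1]),
   (-1,
     [(3, 2, 30, -3, 59, -6, -1), (6, 1, 7, 2, 36, -4, -3), (9, -1, 8, 0, 52, -5, -1),
     (15, -2, 31, -3, 26, -2, -1), (16, 0, 66, -6, 39, -3, -3), (23, -1, 4, 3, 42, -3, -3)],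
     [(3, -5, 23, -6, 30, -5), (7, 0, 20, 1, 46, -6), (0, 1, 4, 2, 35, -2),
     (3, -1, 8, -1, 60, -7), (7, -1, 27, -1, 39, -4), (6, -2, 16, -1, 33, -4),
     (3, 0, 16, -2, 49, -4), (3, 1, 10, -1, 27, -3), (6, -1, 29, -4, 35, -4),
     (10, -2, 29, -5, 52, -7), (3, -2, 16, -3, 40, -5)],
     [3, 1, 1, 1, 1, 1, 1, 1, 2, 1, 2, 1, 1, 2, 1, 3, 1, 2, 1, 2, 1, 1, 1, 1, 2, 1])]"

lemma valid_tables_3: "valid_tables 3 tables_3"
  by code_simp

definition tables_6 :: "table list" where
  "tables_6 = [
   (0,
     [(3, 1, 54, 6, 23, 2, -2), (7, 2, 12, 5, 53, 2, -1), (15, 3, 24, 4, 33, 4, -2),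
     (16, 4, 11, 2, 34, 4, -2), (21, 5, 22, 4, 29, 4, -3), (30, 4, 67, 5, 36, 5, -1)],
     [(11, -3, 29, 1, 53, 1), (0, 4, 18, 5, 43, 7), (4, 0, 8, 2, 25, 4), (0, 2, 7, 0, 56, 5),
     (0, 1, 12, 4, 57, 6), (3, 0, 15, 2, 36, 2), (11, 0, 33, 3, 45, 3), (3, -1, 30, 1, 34, 2),
     (7, 1, 18, 2, 42, 3), (3, -2, 11, -1, 27, 1), (4, -1, 22, 2, 43, 4)],
     [3, 1, 1, 2, 1, 3, 1, 1, 2, 1, 1, 1, 1, 2, 1, 1, 1, 1, 2, 2, 1, 1, 2, 1, 1, 1]),
   (1,
     [(3, 2, 11, 4, 55, 15, -2), (6, 5, 50, 14, 47, 13, -2), (7, 5, 35, 9, 27, 9, -2),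
     (12, 5, 54, 17, 37, 11, -4), (13, 6, 49, 13, 48, 13, -1), (18, 6, 10, 3, 41, 10, 0)],
     [(0, 3, 16, 4, 34, 6), (6, -2, 25, 6, 37, 10), (3, -2, 16, 3, 54, 14), (6, 1, 34, 8, 42, 12),
     (4, 0, 16, 2, 22, 5), (6, 4, 16, 5, 27, 8), (4, 3, 22, 6, 45, 12), (6, 2, 19, 6, 36, 10),
     (0, 1, 13, 2, 38, 9), (4, 1, 21, 6, 48, 11), (3, 0, 7, 4, 34, 11), (3, 1, 7, 3, 13, 3)],
     [3, 1, 2, 1, 1, 2, 1, 1, 1, 1, 2, 1, 1, 1, 2, 1, 1, 1, 1, 2, 1, 2, 1, 3, 1, 1]),
   (2,
     [(3, 3, 11, 6, 55, 27, -2), (6, 4, 26, 10, 40, 18, -1), (9, 6, 47, 20, 37, 17, -1),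
     (10, 6, 8, 4, 30, 15, -4), (17, 10, 25, 11, 27, 14, -2), (20, 7, 64, 27, 36, 17, 0)],
     [(9, 0, 20, 2, 41, 19), (3, -3, 20, 4, 51, 16), (4, 4, 32, 17, 38, 18),
     (9, 2, 27, 10, 41, 17), (3, 2, 14, 6, 30, 11), (3, -2, 9, 1, 55, 22),
     (10, 5, 27, 11, 48, 22), (4, 1, 21, 10, 32, 13), (3, 1, 7, 3, 58, 26), (3, -1, 6, -1, 17, 4),
     (9, 3, 27, 12, 36, 16), (0, 1, 21, 9, 30, 14)],
     [3, 1, 2, 1, 1, 1, 1, 1, 1, 2, 2, 1, 1, 2, 1, 3, 1, 1, 1, 1, 2, 1, 1, 2, 1, 1]),
   (3,
     [(3, 5, 30, 19, 59, 35, -1), (6, 6, 7, 6, 36, 23, -3), (9, 7, 8, 4, 52, 35, -1),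
     (15, 11, 31, 18, 26, 19, -2), (16, 9, 66, 39, 39, 24, 1), (23, 14, 4, 4, 42, 26, -3)],
     [(0, 3, 0, 7, 24, 18), (3, 4, 12, 8, 32, 16), (7, 3, 27, 19, 42, 25), (3, 2, 8, 3, 15, 7),
     (0, 1, 15, 9, 20, 11), (9, 3, 24, 13, 48, 25), (3, 1, 9, 6, 48, 26), (9, 5, 29, 18, 52, 28),
     (3, 0, 29, 14, 32, 17), (13, 8, 26, 18, 46, 27), (3, -1, 29, 15, 46, 25),
     (6, 4, 13, 9, 36, 22)],
     [3, 1, 1, 1, 1, 1, 1, 1, 2, 1, 2, 1, 1, 2, 1, 3, 1, 2, 1, 2, 1, 1, 1, 1, 2, 1]),
   (-2,
     [(3, 2, 11, 0, 55, -11, -4), (6, 2, 26, -3, 40, -7, -4), (9, -1, 47, -12, 37, -8, -1),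
     (10, -1, 8, -1, 30, -5, -2), (17, -3, 25, -4, 27, -7, -1), (20, -4, 64, -15, 36, -7, -1)],
     [(0, 7, 6, 1, 32, -3), (3, -6, 6, -5, 17, -6), (0, 4, 6, 0, 32, -5), (0, 3, 24, -5, 30, -6),
     (4, -2, 16, -6, 20, -5), (3, -3, 28, -8, 34, -10), (7, -2, 16, -4, 58, -15),
     (0, 1, 4, 0, 40, -10), (6, -3, 24, -7, 34, -9), (3, -2, 14, -4, 17, -4),
     (3, -1, 11, -3, 20, -6)],
     [3, 1, 2, 1, 1, 1, 1, 1, 1, 2, 2, 1, 1, 2, 1, 3, 1, 1, 1, 1, 2, 1, 1, 2, 1, 1]),
   (-1,
     [(3, 1, 11, 2, 55, -1, -4), (6, 1, 50, -3, 47, -4, -1), (7, 2, 35, -1, 27, -1, -2),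
     (12, 0, 54, -2, 37, -3, -2), (13, -1, 49, -2, 48, -2, -2), (18, 0, 10, 0, 41, -2, -1)],
     [(3, -5, 6, -5, 17, -4), (0, 4, 4, 1, 16, -1), (3, -1, 22, -2, 45, -4),
     (0, 1, 4, -1, 18, -2), (3, -3, 10, -2, 61, -6), (6, -3, 31, -3, 37, -4),
     (3, -2, 11, -1, 27, -3), (6, 0, 34, -3, 44, -4), (7, 0, 23, -3, 41, -4),
     (6, -2, 14, -2, 48, -3), (4, 0, 17, -2, 55, -3)],
     [3, 1, 2, 1, 1, 2, 1, 1, 1, 1, 2, 1, 1, 1, 2, 1, 1, 1, 1, 2, 1, 2, 1, 3, 1, 1])]"

lemma valid_tables_6: "valid_tables 6 tables_6"
  by code_simp

section \<open>Explicit blocks for at most 26 base blocks\<close>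

definition small_2 :: "block list list" where
  "small_2 = [
   [(1, 9, 11)],
   [(2, 8, 25), (4, 14, 19)],
   [(2, 8, 13), (9, 21, 31), (1, 15, 35)],
   [(6, 10, 34), (7, 12, 15), (13, 14, 33), (2, 23, 41)],
   [(2, 35, 54), (18, 22, 38), (1, 50, 57), (15, 32, 41), (3, 14, 37)],
   [(2, 23, 27), (31, 34, 69), (6, 14, 58), (15, 48, 65), (18, 28, 29), (7, 19, 61)],
   [(16, 18, 42), (22, 39, 79), (12, 61, 75), (10, 31, 58), (3, 8, 85), (30, 45, 80),
   (13, 32, 66)],
   [(13, 43, 48), (47, 59, 92), (31, 58, 95), (41, 73, 87), (8, 23, 44), (10, 28, 29), (7, 9, 81),
   (4, 20, 42)],
   [(9, 22, 65), (6, 27, 44), (12, 42, 62), (7, 32, 46), (4, 23, 28), (3, 11, 40), (2, 33, 49),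
   (1, 35, 53), (10, 36, 51)],
   [(2, 40, 45), (6, 28, 97), (8, 50, 60), (16, 48, 89), (7, 20, 34), (1, 24, 36), (4, 21, 51),
   (18, 37, 76), (3, 57, 66), (11, 26, 55)],
   [(2, 10, 17), (16, 42, 100), (5, 30, 70), (13, 46, 74), (22, 51, 99), (3, 52, 56), (6, 18, 37),
   (9, 23, 47), (20, 41, 95), (1, 45, 72), (11, 43, 79)],
   [(2, 55, 63), (13, 27, 47), (9, 40, 84), (17, 50, 74), (5, 12, 81), (4, 46, 82), (1, 29, 52),
   (15, 54, 103), (25, 60, 105), (3, 21, 59), (11, 30, 109), (6, 22, 32)],
   [(18, 69, 78), (4, 41, 62), (14, 38, 68), (20, 43, 93), (12, 45, 71), (1, 16, 119),
   (2, 34, 86), (6, 13, 122), (5, 27, 88), (3, 11, 105), (17, 46, 127), (19, 47, 114),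
   (10, 35, 92)],
   [(51, 84, 146), (53, 83, 127), (10, 35, 125), (8, 31, 57), (1, 47, 106), (4, 17, 155),
   (9, 29, 110), (3, 14, 70), (5, 12, 39), (2, 38, 99), (37, 77, 129), (16, 58, 79),
   (18, 68, 116), (6, 28, 94)],
   [(90, 135, 178), (21, 89, 108), (11, 57, 86), (25, 51, 155), (9, 50, 110), (10, 58, 113),
   (6, 38, 111), (16, 39, 158), (7, 49, 83), (3, 8, 170), (14, 67, 126), (22, 66, 120),
   (1, 18, 31), (2, 37, 102), (28, 61, 146)],
   [(15, 96, 118), (36, 95, 114), (8, 33, 94), (21, 93, 150), (12, 28, 102), (24, 54, 107),
   (18, 56, 85), (17, 75, 123), (9, 60, 124), (7, 49, 117), (23, 62, 144), (20, 55, 89),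
   (3, 40, 66), (4, 14, 167), (1, 6, 148), (2, 13, 45)],
   [(102, 122, 165), (101, 111, 182), (7, 97, 100), (47, 99, 175), (75, 98, 190), (8, 42, 80),
   (19, 49, 138), (11, 29, 65), (9, 67, 146), (5, 27, 167), (2, 17, 57), (4, 25, 178),
   (6, 56, 142), (35, 83, 129), (1, 13, 74), (26, 59, 144), (14, 51, 96)],
   [(46, 52, 108), (54, 107, 187), (70, 98, 106), (105, 116, 177), (101, 104, 198), (32, 99, 103),
   (27, 64, 123), (22, 47, 73), (7, 45, 75), (9, 21, 158), (17, 65, 83), (1, 16, 195),
   (2, 42, 132), (5, 34, 134), (19, 74, 161), (13, 63, 140), (10, 43, 92), (14, 58, 93)],
   [(25, 114, 177), (97, 113, 209), (38, 111, 129), (28, 110, 219), (4, 108, 163), (48, 107, 151),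
   (46, 87, 106), (30, 77, 135), (8, 37, 102), (13, 70, 158), (12, 45, 176), (3, 27, 83),
   (17, 68, 166), (5, 31, 161), (15, 50, 90), (1, 7, 188), (2, 22, 36), (10, 62, 154),
   (9, 32, 93)],
   [(40, 120, 180), (16, 109, 119), (65, 72, 118), (9, 117, 213), (18, 104, 116), (54, 91, 115),
   (3, 114, 145), (50, 64, 113), (25, 55, 99), (6, 23, 57), (33, 69, 112), (22, 70, 105),
   (1, 27, 42), (13, 45, 203), (20, 78, 155), (28, 101, 160), (21, 68, 157), (2, 90, 94),
   (5, 71, 166), (8, 19, 75)],
   [(6, 48, 126), (80, 125, 201), (124, 162, 235), (21, 106, 123), (27, 122, 225),
   (118, 119, 150), (16, 57, 117), (116, 166, 171), (63, 115, 205), (13, 67, 154), (9, 34, 219),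
   (10, 89, 109), (2, 86, 93), (36, 107, 144), (24, 96, 173), (11, 33, 190), (12, 58, 172),
   (28, 68, 98), (8, 59, 74), (3, 26, 65), (4, 18, 211)],
   [(112, 132, 183), (18, 92, 131), (130, 194, 196), (43, 47, 129), (5, 128, 250), (46, 127, 244),
   (126, 176, 229), (102, 125, 159), (36, 63, 124), (13, 65, 121), (9, 28, 58), (14, 31, 218),
   (24, 115, 170), (35, 89, 190), (10, 69, 114), (1, 95, 98), (11, 40, 84), (6, 93, 105),
   (7, 15, 240), (25, 85, 191), (32, 110, 148), (42, 109, 189)],
   [(9, 138, 176), (7, 137, 199), (107, 136, 196), (1, 44, 135), (50, 75, 133), (113, 116, 132),
   (28, 131, 151), (115, 128, 205), (126, 157, 190), (125, 159, 243), (124, 185, 222),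
   (15, 74, 100), (23, 104, 184), (5, 47, 101), (10, 51, 78), (11, 66, 87), (2, 48, 72),
   (12, 30, 122), (14, 36, 53), (8, 40, 105), (6, 69, 114), (4, 71, 183), (49, 106, 158)],
   [(10, 144, 227), (128, 143, 265), (142, 242, 243), (55, 141, 268), (126, 140, 196),
   (123, 139, 248), (41, 95, 138), (104, 113, 136), (6, 111, 135), (18, 133, 257),
   (132, 184, 223), (65, 82, 131), (2, 37, 81), (28, 62, 254), (38, 99, 216), (8, 68, 188),
   (19, 69, 90), (26, 57, 231), (13, 40, 93), (30, 75, 244), (20, 78, 107), (3, 7, 201),
   (5, 108, 119), (12, 84, 172)],
   [(150, 204, 230), (129, 149, 202), (25, 148, 219), (143, 147, 261), (146, 190, 240),
   (145, 227, 279), (45, 144, 234), (104, 139, 142), (40, 105, 141), (49, 128, 140),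
   (121, 136, 138), (137, 200, 256), (135, 192, 221), (58, 132, 191), (11, 95, 217), (8, 77, 193),
   (24, 88, 127), (10, 43, 215), (9, 76, 124), (14, 30, 61), (32, 66, 242), (1, 7, 281),
   (5, 18, 265), (19, 89, 196), (27, 78, 209)],
   [(76, 122, 156), (153, 155, 178), (154, 201, 278), (3, 152, 222), (41, 151, 209),
   (150, 225, 257), (11, 63, 148), (6, 19, 147), (22, 145, 274), (116, 144, 241), (69, 143, 275),
   (51, 81, 142), (140, 226, 242), (4, 104, 139), (37, 115, 224), (5, 48, 232), (12, 65, 96),
   (8, 64, 106), (20, 49, 103), (9, 27, 126), (1, 15, 195), (24, 50, 270), (33, 71, 254),
   (7, 17, 118), (21, 66, 133), (55, 114, 193)]]"

lemma valid_small_2: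
  "list_all (valid_blocks 2) small_2 \<and> map (\<lambda>bs. int (length bs)) small_2 = [1..26]"
  by code_simp

definition small_3 :: "block list list" where
  "small_3 = [
   [(1, 9, 13)],
   [(1, 6, 31), (2, 18, 29), (3, 20, 35)],
   [(1, 19, 21), (5, 8, 47), (11, 27, 37), (6, 29, 44)],
   [(7, 36, 58), (23, 48, 49), (16, 18, 46), (3, 9, 13), (8, 32, 52)],
   [(1, 22, 57), (12, 43, 48), (6, 20, 29), (16, 24, 65), (3, 33, 71), (2, 17, 64)],
   [(17, 39, 43), (27, 37, 69), (21, 34, 75), (40, 68, 76), (15, 35, 38), (2, 7, 16), (1, 25, 31)],
   [(13, 49, 60), (48, 70, 74), (1, 19, 31), (43, 46, 67), (16, 61, 71), (5, 40, 42), (7, 65, 79),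
   (6, 15, 23)],
   [(1, 39, 55), (4, 28, 80), (19, 41, 88), (11, 29, 62), (3, 9, 53), (7, 17, 43), (8, 21, 48),
   (5, 20, 86), (2, 14, 79)],
   [(1, 40, 46), (8, 24, 95), (2, 35, 50), (11, 30, 64), (5, 26, 68), (4, 17, 27), (7, 44, 58),
   (12, 43, 61), (9, 29, 85), (3, 25, 57)],
   [(7, 15, 80), (2, 34, 77), (10, 36, 76), (4, 41, 57), (1, 19, 50), (6, 33, 54), (11, 24, 46),
   (9, 23, 106), (3, 20, 64), (12, 51, 79), (5, 30, 93)],
   [(1, 27, 63), (2, 66, 82), (11, 23, 123), (3, 54, 60), (7, 29, 99), (8, 21, 38), (9, 40, 114),
   (10, 53, 78), (14, 58, 86), (15, 34, 52), (20, 59, 91), (4, 45, 50)],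
   [(79, 105, 112), (3, 34, 73), (18, 61, 84), (2, 11, 83), (1, 15, 63), (6, 51, 71),
   (21, 49, 85), (19, 41, 101), (24, 56, 124), (4, 16, 29), (5, 42, 109), (8, 46, 115),
   (10, 27, 129)],
   [(6, 85, 153), (72, 84, 148), (30, 65, 123), (2, 39, 71), (7, 34, 74), (15, 66, 109),
   (22, 63, 112), (4, 33, 129), (3, 13, 83), (9, 26, 47), (1, 53, 61), (16, 44, 98), (5, 19, 55),
   (11, 31, 56)],
   [(70, 91, 135), (30, 90, 110), (42, 58, 89), (4, 85, 100), (8, 62, 107), (14, 53, 120),
   (9, 59, 128), (17, 52, 88), (7, 33, 134), (1, 13, 79), (6, 28, 38), (3, 37, 111), (5, 24, 51),
   (2, 25, 43), (11, 40, 126)],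
   [(61, 97, 147), (96, 105, 108), (4, 38, 95), (83, 94, 162), (24, 52, 144), (13, 53, 135),
   (17, 49, 84), (19, 42, 148), (5, 20, 63), (1, 27, 141), (14, 44, 85), (22, 59, 115),
   (7, 69, 77), (18, 39, 64), (6, 16, 123), (2, 31, 76)],
   [(55, 103, 148), (97, 98, 102), (101, 174, 196), (83, 100, 160), (7, 10, 99), (19, 75, 142),
   (6, 37, 128), (14, 35, 53), (13, 49, 76), (8, 74, 125), (15, 38, 164), (25, 54, 175),
   (9, 70, 120), (30, 71, 143), (2, 46, 80), (20, 62, 88), (12, 28, 52)],
   [(24, 109, 201), (28, 108, 172), (107, 126, 184), (3, 106, 210), (17, 49, 105), (76, 102, 147),
   (4, 57, 141), (46, 97, 145), (31, 67, 154), (20, 63, 149), (2, 8, 138), (1, 40, 119),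
   (14, 41, 165), (11, 44, 169), (15, 37, 196), (5, 21, 34), (25, 55, 153), (7, 59, 69)],
   [(5, 115, 177), (84, 114, 216), (70, 113, 220), (96, 112, 202), (36, 111, 159),
   (109, 180, 206), (105, 174, 178), (2, 9, 166), (3, 13, 98), (12, 80, 103), (6, 14, 41),
   (39, 86, 131), (20, 44, 199), (31, 89, 168), (18, 64, 101), (19, 40, 189), (1, 34, 56),
   (28, 78, 171), (17, 66, 104)],
   [(121, 193, 233), (76, 101, 120), (37, 119, 145), (118, 153, 186), (114, 117, 148),
   (38, 115, 116), (113, 156, 173), (27, 75, 111), (5, 71, 93), (29, 59, 163), (14, 42, 65),
   (11, 56, 69), (7, 86, 140), (4, 12, 194), (2, 20, 94), (16, 62, 83), (24, 63, 170),
   (47, 99, 188), (32, 96, 137), (6, 15, 158)],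
   [(76, 127, 197), (89, 126, 246), (125, 140, 213), (90, 124, 153), (123, 171, 178),
   (122, 142, 148), (60, 87, 119), (4, 118, 154), (13, 117, 214), (21, 44, 230), (24, 81, 176),
   (8, 30, 199), (1, 18, 181), (14, 53, 96), (19, 71, 162), (2, 5, 67), (11, 49, 194),
   (16, 47, 155), (12, 45, 80), (10, 50, 156), (28, 94, 172)],
   [(18, 53, 133), (25, 132, 186), (66, 74, 131), (94, 130, 154), (58, 129, 145), (102, 128, 246),
   (7, 34, 127), (40, 103, 126), (47, 95, 125), (75, 124, 238), (11, 43, 194), (12, 82, 182),
   (5, 14, 205), (10, 52, 169), (31, 69, 179), (1, 45, 91), (4, 41, 162), (3, 59, 171),
   (17, 50, 216), (19, 39, 111), (2, 15, 79), (6, 28, 212)],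
   [(50, 62, 139), (64, 138, 237), (90, 137, 191), (84, 91, 136), (108, 135, 210),
   (134, 231, 249), (51, 67, 133), (122, 132, 242), (78, 131, 154), (25, 71, 130), (3, 129, 238),
   (1, 87, 166), (22, 85, 206), (33, 98, 209), (36, 92, 199), (20, 58, 218), (6, 100, 124),
   (4, 39, 156), (28, 60, 211), (8, 57, 112), (2, 15, 260), (11, 40, 83), (5, 14, 31)],
   [(30, 145, 221), (11, 144, 160), (68, 143, 196), (141, 154, 178), (140, 180, 184),
   (25, 117, 139), (48, 120, 138), (87, 101, 136), (41, 93, 135), (7, 134, 236), (81, 132, 179),
   (74, 130, 246), (6, 33, 218), (2, 59, 69), (17, 63, 99), (1, 9, 29), (32, 71, 121),
   (12, 66, 195), (31, 65, 231), (15, 38, 124), (5, 88, 173), (3, 61, 80), (21, 64, 186),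
   (26, 104, 207)],
   [(122, 150, 151), (100, 113, 149), (138, 148, 219), (82, 147, 255), (22, 96, 146),
   (53, 125, 145), (128, 144, 262), (68, 85, 143), (78, 103, 142), (32, 141, 247),
   (137, 140, 276), (102, 135, 172), (98, 133, 171), (15, 34, 258), (5, 47, 251), (18, 44, 226),
   (6, 46, 126), (9, 21, 76), (14, 107, 198), (4, 63, 192), (2, 89, 193), (23, 66, 117),
   (8, 62, 242), (7, 31, 220), (11, 97, 127)],
   [(99, 108, 157), (83, 156, 282), (34, 155, 284), (122, 139, 154), (153, 213, 233),
   (54, 152, 256), (18, 127, 151), (150, 222, 268), (149, 234, 285), (138, 141, 148),
   (147, 208, 248), (2, 146, 220), (89, 145, 279), (143, 196, 267), (19, 64, 204), (6, 50, 120),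
   (14, 100, 187), (13, 88, 205), (8, 63, 84), (43, 112, 178), (35, 92, 131), (29, 91, 132),
   (25, 77, 115), (11, 37, 79), (12, 28, 106), (1, 5, 293)]]"

text \<open>Two blocks would mean order 27, the exceptional pair \<open>(9, 3)\<close>.\<close>

lemma valid_small_3:
  "list_all (valid_blocks 3) small_3 \<and> map (\<lambda>bs. int (length bs)) small_3 = 1 # [3..26]"
  by code_simp

definition small_6 :: "block list list" where
  "small_6 = [
   [(2, 15, 20), (3, 4, 34), (6, 16, 25)],
   [(6, 11, 46), (2, 25, 26), (12, 44, 51), (4, 17, 38)],
   [(2, 8, 59), (10, 26, 47), (17, 20, 52), (4, 27, 28), (5, 18, 30)],
   [(2, 31, 38), (11, 14, 30), (34, 43, 66), (8, 18, 33), (20, 24, 41), (1, 6, 28)],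
   [(20, 44, 51), (18, 47, 73), (9, 34, 57), (32, 37, 86), (10, 16, 38), (19, 27, 40), (1, 3, 79)],
   [(14, 50, 98), (49, 72, 73), (2, 8, 83), (28, 31, 41), (5, 43, 65), (39, 55, 95), (9, 76, 91),
   (12, 45, 70)],
   [(2, 13, 65), (7, 41, 55), (4, 24, 50), (1, 30, 83), (12, 47, 72), (3, 21, 77), (5, 15, 86),
   (8, 17, 44), (6, 22, 45)],
   [(9, 23, 111), (4, 17, 110), (12, 30, 86), (3, 10, 72), (11, 46, 71), (6, 28, 67), (1, 37, 45),
   (2, 43, 77), (19, 48, 95), (5, 32, 58)],
   [(2, 5, 42), (21, 54, 76), (10, 44, 57), (6, 45, 56), (29, 65, 95), (16, 41, 79), (7, 26, 74),
   (12, 27, 80), (1, 52, 61), (4, 24, 32), (14, 31, 49)],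
   [(2, 38, 98), (15, 66, 86), (1, 49, 83), (23, 53, 95), (9, 46, 103), (8, 69, 85), (5, 11, 44),
   (14, 32, 124), (27, 62, 107), (4, 17, 91), (3, 24, 31), (10, 22, 131)],
   [(34, 80, 91), (3, 18, 102), (2, 42, 98), (30, 62, 115), (31, 70, 119), (1, 5, 142),
   (13, 35, 103), (9, 37, 95), (8, 52, 97), (6, 16, 145), (24, 50, 111), (14, 55, 93),
   (7, 19, 133)],
   [(36, 86, 163), (5, 79, 85), (8, 24, 46), (17, 43, 61), (4, 45, 110), (31, 66, 98),
   (12, 37, 90), (1, 15, 57), (7, 27, 119), (13, 34, 73), (10, 40, 115), (9, 28, 111),
   (23, 71, 104), (2, 51, 54)],
   [(56, 92, 173), (91, 97, 152), (74, 90, 157), (19, 49, 82), (17, 54, 133), (10, 21, 121),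
   (24, 59, 101), (1, 26, 58), (3, 8, 23), (22, 73, 120), (4, 18, 45), (28, 76, 115), (2, 9, 52),
   (12, 72, 118), (38, 78, 122)],
   [(3, 25, 98), (48, 97, 162), (20, 96, 135), (80, 94, 137), (17, 87, 108), (2, 11, 174),
   (1, 29, 110), (4, 16, 143), (8, 53, 93), (6, 58, 68), (7, 34, 154), (30, 72, 151),
   (32, 86, 124), (13, 31, 50), (5, 46, 69), (15, 75, 131)],
   [(80, 104, 127), (103, 128, 135), (1, 102, 152), (100, 169, 188), (71, 99, 167), (3, 8, 156),
   (6, 16, 72), (20, 64, 85), (4, 34, 165), (9, 27, 124), (33, 73, 150), (38, 90, 136),
   (2, 13, 91), (12, 48, 63), (14, 31, 157), (26, 55, 149), (37, 76, 118)],
   [(108, 110, 202), (62, 68, 109), (57, 107, 183), (89, 106, 188), (105, 132, 186), (4, 7, 104),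
   (29, 71, 127), (11, 51, 153), (8, 72, 91), (9, 23, 178), (21, 45, 73), (1, 32, 78),
   (25, 60, 163), (10, 43, 65), (15, 85, 101), (5, 63, 93), (13, 61, 79), (12, 38, 87)],
   [(114, 116, 198), (57, 103, 115), (23, 113, 124), (38, 109, 112), (98, 111, 145),
   (59, 108, 161), (7, 26, 107), (4, 48, 76), (1, 22, 92), (5, 25, 65), (30, 62, 129),
   (8, 35, 64), (9, 24, 75), (10, 41, 55), (33, 83, 171), (16, 77, 95), (6, 43, 147),
   (42, 94, 148), (17, 85, 154)],
   [(122, 203, 216), (121, 212, 217), (120, 135, 238), (67, 109, 119), (47, 101, 117),
   (48, 116, 138), (76, 115, 180), (55, 105, 114), (14, 83, 154), (7, 45, 189), (2, 33, 77),
   (20, 56, 153), (1, 19, 167), (6, 84, 157), (4, 21, 53), (28, 86, 186), (3, 26, 209),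
   (11, 46, 185), (24, 51, 136), (12, 74, 99)],
   [(128, 248, 252), (127, 177, 235), (126, 190, 210), (79, 113, 125), (30, 123, 233),
   (122, 205, 240), (69, 105, 121), (13, 119, 181), (19, 75, 117), (37, 100, 151), (8, 49, 82),
   (2, 11, 229), (45, 102, 149), (17, 78, 116), (14, 103, 157), (7, 22, 92), (5, 26, 219),
   (27, 59, 87), (1, 67, 147), (24, 95, 186), (3, 76, 164)],
   [(128, 134, 267), (132, 158, 159), (62, 130, 153), (129, 154, 166), (113, 127, 182),
   (5, 80, 126), (43, 67, 125), (28, 107, 124), (123, 189, 231), (7, 122, 206), (15, 92, 175),
   (13, 102, 165), (21, 56, 217), (20, 60, 93), (44, 94, 194), (8, 59, 106), (9, 19, 57),
   (29, 78, 114), (11, 41, 72), (2, 99, 103), (16, 34, 86), (22, 54, 205)],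
   [(11, 140, 223), (19, 25, 139), (84, 138, 214), (137, 173, 190), (9, 126, 136), (40, 101, 135),
   (22, 113, 134), (55, 133, 183), (88, 132, 196), (51, 131, 172), (125, 185, 192), (27, 66, 123),
   (14, 49, 244), (2, 18, 124), (1, 24, 82), (4, 37, 79), (30, 62, 107), (8, 20, 217),
   (5, 103, 116), (3, 31, 105), (29, 100, 193), (26, 69, 236), (15, 63, 119)],
   [(146, 200, 287), (6, 145, 211), (17, 128, 144), (13, 106, 143), (142, 175, 221),
   (14, 140, 190), (57, 102, 138), (62, 115, 137), (11, 116, 136), (74, 135, 267), (56, 134, 230),
   (41, 110, 133), (9, 21, 186), (18, 88, 209), (39, 97, 210), (19, 114, 182), (10, 82, 204),
   (38, 80, 124), (2, 32, 109), (25, 59, 254), (8, 43, 71), (15, 67, 91), (1, 4, 247),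
   (5, 31, 60)],
   [(72, 78, 152), (34, 151, 162), (150, 180, 223), (65, 149, 177), (90, 148, 236),
   (133, 147, 260), (63, 145, 195), (138, 142, 143), (141, 196, 249), (26, 125, 140),
   (123, 139, 215), (2, 137, 186), (136, 175, 202), (18, 40, 227), (3, 44, 103), (33, 69, 254),
   (19, 81, 105), (38, 94, 210), (7, 54, 75), (10, 23, 71), (32, 67, 109), (8, 25, 45),
   (9, 107, 200), (29, 60, 124), (12, 101, 188)],
   [(86, 158, 182), (74, 87, 157), (71, 107, 156), (44, 108, 155), (138, 154, 188), (62, 80, 153),
   (68, 75, 152), (151, 276, 285), (113, 150, 242), (149, 261, 266), (126, 148, 174),
   (25, 147, 278), (115, 116, 146), (89, 104, 145), (2, 29, 259), (4, 10, 225), (8, 90, 135),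
   (28, 95, 218), (3, 54, 258), (14, 69, 208), (12, 32, 133), (43, 141, 219), (19, 58, 137),
   (17, 38, 119), (11, 46, 224), (23, 132, 198)]]"

text \<open>One or two blocks would mean \<open>g = 3\<close> or \<open>g = 5\<close>, for which no
  CDF exists.\<close>

lemma valid_small_6:
  "list_all (valid_blocks 6) small_6 \<and> map (\<lambda>bs. int (length bs)) small_6 = [3..26]"
  by code_simp

section \<open>Nonexistence\<close>

text \<open>Ordered so that clashes show up early in the search.\<close>

definition block_residues :: "int \<Rightarrow> int \<Rightarrow> int \<Rightarrow> int \<Rightarrow> int list" where
  "block_residues v x a b =
    map (\<lambda>d. d mod v) [b - a, a - b, x, - x, a, - a, a - x, x - a, b, - b, b - x, x - b]"

text \<open>The conditional ends the evaluation at the first clash.\<close>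

fun fresh :: "int \<Rightarrow> int list \<Rightarrow> int list \<Rightarrow> bool" where
  "fresh g [] ds \<longleftrightarrow> True"
| "fresh g (d # es) ds \<longleftrightarrow> (if g dvd d \<or> d \<in> set ds then False else fresh g es (d # ds))"

text \<open>Prunes the search: candidates for a further point of a block containing 0 and
  \<open>x\<close>, judged by their differences with these two points alone.\<close>

definition extensions :: "int \<Rightarrow> int \<Rightarrow> int list \<Rightarrow> int \<Rightarrow> int list" where
  "extensions g v ds x = filter (\<lambda>a. fresh g (map (\<lambda>d. d mod v) [a, a - x, - a, x - a]) ds) [0..v - 1]"

text \<open>The least residue not yet represented must be a difference of the second block, which
  may thus be taken as \<open>{0, d, a, b}\<close> with \<open>a < b\<close>. If nothing is left to
  represent, the test refuses to exclude a second block.\<close>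

definition no_second_block :: "int \<Rightarrow> int \<Rightarrow> int list \<Rightarrow> bool" where
  "no_second_block g v ds \<longleftrightarrow>
    (case filter (\<lambda>d. \<not> g dvd d \<and> d \<notin> set ds) [1..v - 1] of
       [] \<Rightarrow> False
     | d # _ \<Rightarrow>
       let cs = extensions g v ds d
       in list_all (\<lambda>a. list_all (\<lambda>b. if a < b then \<not> fresh g (block_residues v d a b) ds else True) cs) cs)"

text \<open>One of the two blocks has 1 as a difference, so up to translation it is
  \<open>{0, 1, a, b}\<close>.\<close>

definition no_two_blocks :: "int \<Rightarrow> int \<Rightarrow> bool" where
  "no_two_blocks g v \<longleftrightarrow>
    (let cs = extensions g v [] 1
     in list_all (\<lambda>a. list_all (\<lambda>b.
          if a < b then
            (if fresh g (block_residues v 1 a b) [] then no_second_block g v (block_residues v 1 a b) else True)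
          else True) cs) cs)"

lemma freshI: "distinct (es @ ds) \<Longrightarrow> (\<And>d. d \<in> set es \<Longrightarrow> \<not> g dvd d) \<Longrightarrow> fresh g es ds"
proof (induction es arbitrary: ds)
  case (Cons e es)
  then have "fresh g es (e # ds)" by (intro Cons.IH) auto
  then show ?case using Cons.prems by auto
qed simp

section \<open>Normal form of a block with a prescribed difference\<close>

lemma differences_block:
  assumes v: "0 < v" and A: "A \<subseteq> {0..<int v}" "A = {p, q, r, s}" "distinct [p, q, r, s]"
  shows "differences v A =
    mset (block_residues (int v) ((p - q) mod int v) ((r - q) mod int v) ((s - q) mod int v))"
proof -
  \<comment> \<open>The pairs are listed in the order of \<open>block_residues\<close>, with
    \<open>q\<close> translated to 0.\<close>
  define ps where "ps = [(s, r), (r, s), (p, q), (q, p), (r, q), (q, r),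
    (r, p), (p, r), (s, q), (q, s), (s, p), (p, s)]"
  have "{(x, y). x \<in> A \<and> y \<in> A \<and> x \<noteq> y} = set ps"
    using A(2,3) unfolding ps_def by auto
  moreover have "distinct ps" using A(3) unfolding ps_def by auto
  ultimately have "differences v A = mset (map (\<lambda>(x, y). (x - y) mod int v) ps)"
    using v A(1) by (subst differences_eq) (simp_all add: carrier_integer_mod_group mset_set_set)
  also have "map (\<lambda>(x, y). (x - y) mod int v) ps =
      block_residues (int v) ((p - q) mod int v) ((r - q) mod int v) ((s - q) mod int v)"
    unfolding ps_def block_residues_def by (simp add: mod_simps)
  finally show ?thesis .
qed

text \<open>Write \<open>d\<close> as \<open>p - q\<close> and translate \<open>q\<close> to 0;
  exchanging the two other points achieves \<open>a < b\<close>.\<close>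

lemma differences_block_residues:
  assumes v: "0 < v" and A: "A \<subseteq> {0..<int v}" "card A = 4" and d: "d \<in># differences v A"
  shows "\<exists>a b. 0 \<le> a \<and> a < b \<and> b < int v \<and> differences v A = mset (block_residues (int v) d a b)"
proof -
  obtain p q where pq: "p \<in> A" "q \<in> A" "p \<noteq> q" "d = (p - q) mod int v"
    using d unfolding mem_differences_iff[OF v A(1)] by blast
  then have "card (A - {p, q}) = 2" using A(2) by (simp add: card_Diff_subset)
  then obtain r s where rs: "A - {p, q} = {r, s}" "r \<noteq> s" by (auto simp: card_2_iff)
  then have "A = {p, q, r, s}" "A = {p, q, s, r}" "distinct [p, q, r, s]" "distinct [p, q, s, r]"
    using pq by auto
  note eq = differences_block[OF v A(1) this(1,3)] differences_block[OF v A(1) this(2,4)]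
  have "(r - q) mod int v \<noteq> (s - q) mod int v"
  proof
    assume "(r - q) mod int v = (s - q) mod int v"
    then have "((r - q) mod int v + q) mod int v = ((s - q) mod int v + q) mod int v" by simp
    then have "r mod int v = s mod int v" by (simp add: mod_simps)
    moreover have "r \<in> {0..<int v}" "s \<in> {0..<int v}" using rs(1) A(1) by blast+
    ultimately show False using rs(2) by simp
  qed
  then consider "(r - q) mod int v < (s - q) mod int v" | "(s - q) mod int v < (r - q) mod int v"
    by linarith
  then show ?thesis
  proof cases
    case 1
    then show ?thesis using eq(1) pq(4) v
      by (intro exI[of _ "(r - q) mod int v"] exI[of _ "(s - q) mod int v"]) auto
  next
    case 2
    then show ?thesis using eq(2) pq(4) v
      by (intro exI[of _ "(s - q) mod int v"] exI[of _ "(r - q) mod int v"]) auto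
  qed
qed

lemma distinct_if_mset_eq_mset_set:
  assumes "mset xs = mset_set T"
  shows "distinct xs"
proof -
  have "count (mset xs) x \<le> 1" for x unfolding assms by (simp add: count_mset_set')
  then have "count (mset xs) x = (if x \<in> set xs then 1 else 0)" for x
    by (metis count_eq_zero_iff le_0_eq less_one nat_less_le set_mset_mset)
  then show ?thesis by (simp add: distinct_count_atmost_1)
qed

lemma mem_extensions:
  assumes "0 \<le> a" "0 \<le> b" "a < v" "b < v" "distinct (block_residues v x a b @ ds)"
    and "\<And>d. d \<in> set (block_residues v x a b) \<Longrightarrow> \<not> g dvd d"
  shows "a \<in> set (extensions g v ds x)" "b \<in> set (extensions g v ds x)"
proof -
  \<comment> \<open>The letters are positions in \<open>block_residues\<close>: after
    \<open>b - a\<close>, \<open>a - b\<close>, \<open>x\<close>, \<open>- x\<close> come the four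
    entries of \<open>a\<close> and then those of \<open>b\<close>, permuted here into the order of
    \<open>extensions\<close>.\<close>
  have sub: "distinct ([c, e, d, f] @ ds) \<and> distinct ([c', e', d', f'] @ ds)"
    if "distinct ([p, q, r, s, c, d, e, f, c', d', e', f'] @ ds)" for p q r s c d e f c' d' e' f' :: int
    using that by auto
  note dist = sub[OF assms(5)[unfolded block_residues_def list.map]]
  have "fresh g (map (\<lambda>d. d mod v) [a, a - x, - a, x - a]) ds"
    using dist assms(6) unfolding block_residues_def by (intro freshI) auto
  moreover have "fresh g (map (\<lambda>d. d mod v) [b, b - x, - b, x - b]) ds"
    using dist assms(6) unfolding block_residues_def by (intro freshI) auto
  ultimately show "a \<in> set (extensions g v ds x)" "b \<in> set (extensions g v ds x)"
    using assms(1-4) unfolding extensions_def by (simp_all del: fresh.simps list.map)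
qed

text \<open>This order forces exactly two blocks. Their 24 differences are distinct and avoid the
  subgroup, so the actual blocks would survive the search.\<close>

lemma not_is_CDF_if_no_two_blocks:
  assumes g: "1 < g" "0 < h" "g * h = 24 + h" and no: "no_two_blocks (int g) (int (g * h))"
  shows "\<not> is_CDF g h 4 \<F>"
proof
  assume CDF: "is_CDF g h 4 \<F>"
  define v where "v = g * h"
  let ?T = "relative_residues g h"
  have g0: "0 < g" and v0: "0 < v" using g by (auto simp: v_def)
  note iff = is_CDF_iff[OF g0 g(2), folded v_def]
  have "card \<F> = 2" using card_CDF[OF g0 g(2) CDF] g(3) by simp
  then obtain A B where AB: "\<F> = {A, B}" "A \<noteq> B" by (auto simp: card_2_iff)
  have sum: "differences v A + differences v B = mset_set ?T"
    using CDF AB by (simp add: iff)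
  have blocks: "A \<subseteq> {0..<int v}" "card A = 4" "B \<subseteq> {0..<int v}" "card B = 4"
    using CDF AB unfolding iff by auto
  \<comment> \<open>Stated for arbitrary \<open>A\<close> and \<open>B\<close> because it is applied
    in both orders, depending on which block has the difference 1.\<close>
  have contra: False
    if A: "A \<subseteq> {0..<int v}" "card A = 4" and B: "B \<subseteq> {0..<int v}" "card B = 4"
      and sum: "differences v A + differences v B = mset_set ?T" and one: "1 \<in># differences v A" for A B
  proof -
    obtain a b where ab: "0 \<le> a" "a < b" "b < int v"
      and DA: "differences v A = mset (block_residues (int v) 1 a b)"
      using differences_block_residues[OF v0 A one] by blast
    let ?D = "block_residues (int v) 1 a b"
    obtain xs where "differences v B = mset xs" by (metis ex_mset)
    then have "mset (?D @ xs) = mset_set ?T" using sum DA by simp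
    then have "distinct (?D @ [])" using distinct_if_mset_eq_mset_set by fastforce
    moreover have T: "d \<in> ?T" if "d \<in> set ?D" for d
    proof -
      have "d \<in># mset_set ?T" using that sum DA by (metis set_mset_mset union_iff)
      then show ?thesis by simp
    qed
    then have nd: "\<not> int g dvd d" if "d \<in> set ?D" for d
      using that by (auto simp: relative_residues_def)
    ultimately have "fresh (int g) ?D []"
      "a \<in> set (extensions (int g) (int v) [] 1)" "b \<in> set (extensions (int g) (int v) [] 1)"
      using ab freshI[of ?D "[]" "int g"] mem_extensions[of a b "int v" 1 "[]" "int g"] by auto
    then have "no_second_block (int g) (int v) ?D"
      using no ab(2) unfolding v_def[symmetric] no_two_blocks_def Let_def list_all_iff by auto
    \<comment> \<open>The search has a residue \<open>d\<close> to branch on, as its empty case is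
      \<open>False\<close>; not being a difference of \<open>A\<close>, it must come from
      \<open>B\<close>.\<close>
    then obtain d es where first: "filter (\<lambda>d. \<not> int g dvd d \<and> d \<notin> set ?D) [1..int v - 1] = d # es"
      and second: "\<forall>a' \<in> set (extensions (int g) (int v) ?D d). \<forall>b' \<in> set (extensions (int g) (int v) ?D d).
        a' < b' \<longrightarrow> \<not> fresh (int g) (block_residues (int v) d a' b') ?D"
      unfolding no_second_block_def Let_def list_all_iff by (auto split: list.splits if_splits)
    have "d \<in> set (filter (\<lambda>d. \<not> int g dvd d \<and> d \<notin> set ?D) [1..int v - 1])"
      unfolding first by simp
    then have d: "1 \<le> d" "d < int v" "\<not> int g dvd d" "d \<notin> set ?D" by auto
    have "d \<in> ?T" using d by (simp add: relative_residues_def v_def)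
    then have "d \<in># mset_set ?T" by simp
    then have "d \<in># differences v B" using d(4) DA by (metis set_mset_mset sum union_iff)
    from differences_block_residues[OF v0 B this] obtain a' b' where ab': "0 \<le> a'" "a' < b'" "b' < int v"
      and DB: "differences v B = mset (block_residues (int v) d a' b')" by blast
    let ?E = "block_residues (int v) d a' b'"
    have "mset (?E @ ?D) = mset_set ?T" using sum DA DB by (simp add: union_commute)
    then have dist: "distinct (?E @ ?D)" by (rule distinct_if_mset_eq_mset_set)
    have nd': "\<not> int g dvd e" if "e \<in> set ?E" for e
    proof -
      have "e \<in># mset_set ?T" using that sum DB by (metis set_mset_mset union_iff)
      then have "e \<in> ?T" by simp
      then show ?thesis by (simp add: relative_residues_def)
    qed
    show False
      using second mem_extensions[of a' b' "int v" d ?D "int g"] ab' dist nd' freshI[OF dist] by auto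
  qed
  have "1 \<in> ?T" using g by (simp add: relative_residues_def flip: of_nat_mult)
  then have "1 \<in># mset_set ?T" by simp
  then have "1 \<in># differences v A \<or> 1 \<in># differences v B" by (metis sum union_iff)
  then show False
    using contra[of A B] contra[of B A] blocks sum by (auto simp: union_commute)
qed

text \<open>Pigeonhole: two of the four points of a block agree modulo 3, and their difference falls
  into the subgroup.\<close>

lemma not_is_CDF_3_6: "\<not> is_CDF 3 6 4 \<F>"
proof
  assume CDF: "is_CDF 3 6 4 \<F>"
  then obtain F where F: "F \<in> \<F>" "F \<subseteq> {0..<18}" "card F = 4" by (auto simp: is_CDF_iff)
  have "\<not> inj_on (\<lambda>x. x mod 3) F"
  proof
    assume "inj_on (\<lambda>x. x mod 3) F"
    then have "card F \<le> card {0..<3 :: int}" by (intro card_inj_on_le) auto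
    then show False using F by simp
  qed
  then obtain x y where xy: "x \<in> F" "y \<in> F" "x \<noteq> y" "x mod 3 = y mod 3" by (auto simp: inj_on_def)
  have "(x - y) mod 18 \<in># differences 18 F"
    using mem_differences_iff[of 18 F] F(2) xy by auto
  moreover have "finite \<F>" using finite_CDF[OF _ _ CDF] by simp
  ultimately have "(x - y) mod 18 \<in># (\<Sum>F\<in>\<F>. differences 18 F)"
    using F(1) by (auto simp: set_mset_sum)
  then have "(x - y) mod 18 \<in># mset_set (relative_residues 3 6)"
    using CDF by (simp add: is_CDF_iff)
  then have "(x - y) mod 18 \<in> relative_residues 3 6" by simp
  moreover have "3 dvd (x - y) mod 18" using xy(4) by (simp add: dvd_mod_iff mod_eq_dvd_iff)
  ultimately show False by (simp add: relative_residues_def)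
qed

lemma not_is_CDF_5_6: "\<not> is_CDF 5 6 4 \<F>"
proof -
  have "no_two_blocks 5 30" by code_simp
  then show ?thesis using not_is_CDF_if_no_two_blocks[of 5 6] by simp
qed

lemma not_is_CDF_9_3: "\<not> is_CDF 9 3 4 \<F>"
proof -
  have "no_two_blocks 9 27" by code_simp
  then show ?thesis using not_is_CDF_if_no_two_blocks[of 9 3] by simp
qed

section \<open>The existence theorem\<close>

theorem theorem1p2:
  fixes g h :: nat
  assumes "h \<in> {2, 3, 6}" and "0 < g"
  shows "(\<exists>\<F>. is_CDF g h 4 \<F>) \<longleftrightarrow>
    [g * h = h] (mod 12) \<and> 4 \<le> g \<and> (g, h) \<notin> {(9, 3), (5, 6)}"
proof
  assume "\<exists>\<F>. is_CDF g h 4 \<F>"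
  then obtain \<F> where CDF: "is_CDF g h 4 \<F>" ..
  have h: "0 < h" using assms(1) by auto
  have "h \<le> g * h" using assms(2) by simp
  then have eq: "g * h = 12 * card \<F> + h" using card_CDF[OF assms(2) h CDF] by linarith
  have "card \<F> \<noteq> 0"
    using CDF finite_CDF[OF assms(2) h CDF] by (auto simp: is_CDF_def)
  \<comment> \<open>With at least one block, \<open>g\<close> is at least 7, 5 or 3 for
    \<open>h\<close> equal to 2, 3 or 6; hence \<open>(3, 6)\<close> is the only case to rule out
    for \<open>4 \<le> g\<close>.\<close>
  moreover have "(g, h) \<notin> {(3, 6), (9, 3), (5, 6)}"
    using CDF not_is_CDF_3_6 not_is_CDF_9_3 not_is_CDF_5_6 by auto
  moreover have "[g * h = h] (mod 12)" unfolding eq by (simp add: cong_def)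
  ultimately show "[g * h = h] (mod 12) \<and> 4 \<le> g \<and> (g, h) \<notin> {(9, 3), (5, 6)}"
    using assms(1) eq by (elim insertE emptyE) (simp; presburger)+
next
  assume *: "[g * h = h] (mod 12) \<and> 4 \<le> g \<and> (g, h) \<notin> {(9, 3), (5, 6)}"
  then have "12 dvd g * h - h" using assms(2) by (simp add: cong_altdef_nat)
  then obtain t where "g * h - h = 12 * t" ..
  moreover have "h \<le> g * h" using assms(2) by simp
  ultimately have t: "g * h = 12 * t + h" by linarith
  show "\<exists>\<F>. is_CDF g h 4 \<F>"
  proof (cases "27 \<le> t")
    case True
    then show ?thesis
      using exists_CDF_if_valid_tables[OF assms(1) t] valid_tables_2 valid_tables_3 valid_tables_6
        assms(1) by auto
  next
    case False
    from assms(1) consider "h = 2" | "h = 3" | "h = 6" by blast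
    then show ?thesis
    proof cases
      case 1
      \<comment> \<open>\<open>t = 0\<close> would give \<open>g = 1\<close>.\<close>
      then have "1 \<le> t" using t * by auto
      then have "0 < t" and mem: "int t \<in> set [1..26]"
        using False unfolding list.set set_upto insert_iff atLeastAtMost_iff by linarith+
      then show ?thesis
        using valid_small_2 1 by (intro exists_CDF_if_valid_small[OF _ t _ _ mem]) simp_all
    next
      case 2
      \<comment> \<open>\<open>t = 2\<close> would give the excluded \<open>g = 9\<close>.\<close>
      then have "t = 1 \<or> 3 \<le> t" using t * by auto
      then have "0 < t" and mem: "int t \<in> set (1 # [3..26])"
        using False unfolding list.set set_upto insert_iff atLeastAtMost_iff by linarith+
      then show ?thesis
        using valid_small_3 2 by (intro exists_CDF_if_valid_small[OF _ t _ _ mem]) simp_all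
    next
      case 3
      then have "g = 2 * t + 1" using t by simp
      \<comment> \<open>\<open>t = 1\<close> gives \<open>g = 3\<close>, which is too small, and
        \<open>t = 2\<close> gives the excluded \<open>g = 5\<close>.\<close>
      then have "3 \<le> t" using * 3 by auto
      then have "0 < t" and mem: "int t \<in> set [3..26]"
        using False unfolding list.set set_upto insert_iff atLeastAtMost_iff by linarith+
      then show ?thesis
        using valid_small_6 3 by (intro exists_CDF_if_valid_small[OF _ t _ _ mem]) simp_all
    qed
  qed
qed

end
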